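(* Let $k$ be an algebraically closed field of characteristic $0$, let $m, n \in \mathbb{N}$, and let $\mathbf{f} = (f_1,\ldots,f_m)$ be a sequence of algebraically independent (over $k$) polynomials in $k[t_1,\ldots,t_n]$. Then the following are equivalent: (1) $k\langle f_1,\ldots,f_m\rangle = k[f_1,\ldots,f_m]$. (2) $\mathbf{f}$ is almost surjective on $k$.
   Context: $\mathbb{N}$ denotes the positive integers. For $f_1,\ldots,f_m \in k[t_1,\ldots,t_n]$, a polynomial $g \in k[t_1,\ldots,t_n]$ is determined by $(f_1,\ldots,f_m)$ if for all $\mathbf{a},\mathbf{b} \in k^n$ with $f_i(\mathbf{a}) = f_i(\mathbf{b})$ for all $i \in \{1,\ldots,m\}$ we have $g(\mathbf{a}) = g(\mathbf{b})$. $k\langle f_1,\ldots,f_m\rangle$ denotes the set (a $k$-subalgebra) of all polynomials in $k[t_1,\ldots,t_n]$ determined by $(f_1,\ldots,f_m)$. $k[f_1,\ldots,f_m]$ denotes the $k$-subalgebra of $k[t_1,\ldots,t_n]$ generated by $\{f_1,\ldots,f_m\}$. An algebraic set in $k^m$ is the set of common zeroes of a set of polynomials in $k[x_1,\ldots,x_m]$. The dimension $\dim(A)$ of an algebraic set $A \subseteq k^m$ with vanishing ideal $I(A)$ is the maximal $d \in \{0,\ldots,m\}$ such that there are $i_1 < \cdots < i_d$ in $\{1,\ldots,m\}$ with $I(A) \cap k[x_{i_1},\ldots,x_{i_d}] = \{0\}$, and $\dim(\emptyset) := -1$. $\mathbf{f}$ is almost surjective on $k$ if the Zariski-closure of $k^m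 \setminus \mathrm{range}(\mathbf{f})$ has dimension at most $m-2$, where $\mathrm{range}(\mathbf{f}) = \{(f_1(\mathbf{a}),\ldots,f_m(\mathbf{a})) \mid \mathbf{a} \in k^n\} \subseteq k^m$. *)

theory Defs
  imports
    "HOL-Library.Poly_Mapping"
    "HOL-Library.FuncSet"
    "HOL-Computational_Algebra.Polynomial"
begin

text \<open>
  Polynomials in the variables $t_0, t_1, t_2, \dots$, as finitely supported maps from monomials
  (exponent vectors) to coefficients; the ring structure is the convolution one of the library.
  The ring $k[t_1,\dots,t_n]$ is the carrier \<open>polys_in {1..n}\<close>; the variables $x_i$ of $k^m$ are
  represented by the same indices.
\<close>

type_synonym 'a mpoly = "(nat \<Rightarrow>\<^sub>0 nat) \<Rightarrow>\<^sub>0 'a"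

definition polys_in :: "nat set \<Rightarrow> 'a::zero mpoly set" where
  "polys_in V = {p. \<forall>\<mu>\<in>Poly_Mapping.keys p. Poly_Mapping.keys \<mu> \<subseteq> V}"

definition const_poly :: "'a::zero \<Rightarrow> 'a mpoly" where
  "const_poly c = Poly_Mapping.single 0 c"

text \<open>Substitution of \<open>x i\<close> for the \<open>i\<close>-th variable, with coefficients mapped by \<open>h\<close>.\<close>

definition substitute :: "('a::zero \<Rightarrow> 'b::comm_semiring_1) \<Rightarrow> (nat \<Rightarrow> 'b) \<Rightarrow> 'a mpoly \<Rightarrow> 'b" where
  "substitute h x p = (\<Sum>\<mu>\<in>Poly_Mapping.keys p.
     h (Poly_Mapping.lookup p \<mu>) * (\<Prod>i\<in>Poly_Mapping.keys \<mu>. x i ^ Poly_Mapping.lookup \<mu> i))"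

definition eval_poly :: "(nat \<Rightarrow> 'a::comm_semiring_1) \<Rightarrow> 'a mpoly \<Rightarrow> 'a" where
  "eval_poly a p = substitute (\<lambda>c. c) a p"

definition compose_poly :: "(nat \<Rightarrow> 'a::comm_semiring_1 mpoly) \<Rightarrow> 'a mpoly \<Rightarrow> 'a mpoly" where
  "compose_poly f p = substitute const_poly f p"

text \<open>$k^n$; the values outside \<open>{1..n}\<close> are fixed, so that a point is exactly an $n$-tuple.\<close>

definition affine_space :: "nat \<Rightarrow> (nat \<Rightarrow> 'a) set" where
  "affine_space n = {1..n} \<rightarrow>\<^sub>E UNIV"

definition algebraically_independent :: "nat \<Rightarrow> (nat \<Rightarrow> 'a::comm_semiring_1 mpoly) \<Rightarrow> bool" where
  "algebraically_independent m f \<longleftrightarrow> (\<forall>p\<in>polys_in {1..m}. compose_poly f p = 0 \<longrightarrow> p = 0)"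

definition determined_polys :: "nat \<Rightarrow> nat \<Rightarrow> (nat \<Rightarrow> 'a::comm_semiring_1 mpoly) \<Rightarrow> 'a mpoly set" where
  "determined_polys n m f = {g \<in> polys_in {1..n}.
     \<forall>a\<in>affine_space n. \<forall>b\<in>affine_space n.
       (\<forall>i\<in>{1..m}. eval_poly a (f i) = eval_poly b (f i)) \<longrightarrow> eval_poly a g = eval_poly b g}"

definition is_subalgebra :: "'a::comm_semiring_1 mpoly set \<Rightarrow> bool" where
  "is_subalgebra S \<longleftrightarrow> range const_poly \<subseteq> S \<and> (\<forall>p\<in>S. \<forall>q\<in>S. p + q \<in> S \<and> p * q \<in> S)"

definition generated_subalgebra :: "'a::comm_semiring_1 mpoly set \<Rightarrow> 'a mpoly set" where
  "generated_subalgebra F = is_subalgebra hull F"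

definition algebraic_set :: "nat \<Rightarrow> (nat \<Rightarrow> 'a::comm_semiring_1) set \<Rightarrow> bool" where
  "algebraic_set m A \<longleftrightarrow>
     (\<exists>P\<subseteq>polys_in {1..m}. A = {a \<in> affine_space m. \<forall>p\<in>P. eval_poly a p = 0})"

definition zariski_closure :: "nat \<Rightarrow> (nat \<Rightarrow> 'a::comm_semiring_1) set \<Rightarrow> (nat \<Rightarrow> 'a) set" where
  "zariski_closure m S = algebraic_set m hull S"

definition vanishing_ideal :: "nat \<Rightarrow> (nat \<Rightarrow> 'a::comm_semiring_1) set \<Rightarrow> 'a mpoly set" where
  "vanishing_ideal m A = {p \<in> polys_in {1..m}. \<forall>a\<in>A. eval_poly a p = 0}"

definition algebraic_dim :: "nat \<Rightarrow> (nat \<Rightarrow> 'a::comm_semiring_1) set \<Rightarrow> int" where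
  "algebraic_dim m A =
     (if A = {} then -1
      else int (Max {card D | D. D \<subseteq> {1..m} \<and> vanishing_ideal m A \<inter> polys_in D = {0}}))"

definition range_map :: "nat \<Rightarrow> nat \<Rightarrow> (nat \<Rightarrow> 'a::comm_semiring_1 mpoly) \<Rightarrow> (nat \<Rightarrow> 'a) set" where
  "range_map n m f = {\<lambda>i\<in>{1..m}. eval_poly a (f i) | a. a \<in> affine_space n}"

definition almost_surjective :: "nat \<Rightarrow> nat \<Rightarrow> (nat \<Rightarrow> 'a::comm_semiring_1 mpoly) \<Rightarrow> bool" where
  "almost_surjective n m f \<longleftrightarrow>
     algebraic_dim m (zariski_closure m (affine_space m - range_map n m f)) \<le> int m - 2"

end

theory Submission
  imports Defs
begin

text \<open>
  Everything happens in one distinguished variable at a time: a polynomial in the variables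
  \<open>insert j V\<close> is a univariate polynomial in $x_j$ over $k[x_V]$, and pseudo-division replaces division
  over the fraction field. Two facts carry the argument. First, images of polynomial maps are
  constructible (Chevalley, by eliminating one variable after the other). Second, if $P$ divides
  $d_j Q$ for every $j$, where $d_j \neq 0$ does not involve $x_j$, then $P$ divides $Q$; this takes the
  place of unique factorisation, and it also gives the Nullstellensatz for principal ideals.

  If $\mathbf f$ is not almost surjective, constructibility gives a set
  $\{p = 0, q \neq 0\} \neq \emptyset$ outside the image, so $p(\mathbf f)$ divides some $q(\mathbf f)^r$.
  The polynomial $q(\mathbf f)^{r+1}/p(\mathbf f)$ is determined by $\mathbf f$; were it $s(\mathbf f)$,
  then $p s = q^{r+1}$, which fails at a point of that set.

  Conversely, if $g$ is determined by $\mathbf f$, then generically its graph over the image is the zero set of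
  a polynomial $w(x, y)$ with a single root $y$; in characteristic 0 this root is rational in the
  coefficients of $w$, so $q(\mathbf f)\, g = p(\mathbf f)$. Once $p$ and $q$ are made coprime over
  $k(x_i : i \neq j)$, the set $\{q = 0, p \neq 0\}$ lies outside the image; almost surjectivity
  then forces $q$ not to involve $x_j$. As this holds for every $j$, $q$ divides $p$.
\<close>

section \<open>Evaluation and composition of polynomials\<close>

definition Var :: "nat \<Rightarrow> 'a::comm_semiring_1 mpoly" where
  "Var i = Poly_Mapping.single (Poly_Mapping.single i 1) 1"

text \<open>Evaluation, composition, \<open>uni\<close> and \<open>specialise a\<close> are all
  instances, so that rules such as those for powers are proved once and inherited.\<close>

definition semiring_hom :: "('a::comm_semiring_1 \<Rightarrow> 'b::comm_semiring_1) \<Rightarrow> bool" where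
  "semiring_hom h \<longleftrightarrow> h 0 = 0 \<and> h 1 = 1 \<and> (\<forall>a b. h (a + b) = h a + h b) \<and> (\<forall>a b. h (a * b) = h a * h b)"

lemma semiring_hom_power: "semiring_hom h \<Longrightarrow> h (a ^ n) = h a ^ n"
  by (induction n) (auto simp: semiring_hom_def)

lemma semiring_hom_sum: "semiring_hom h \<Longrightarrow> h (sum g S) = (\<Sum>i\<in>S. h (g i))"
  by (induction S rule: infinite_finite_induct) (auto simp: semiring_hom_def)

lemma semiring_hom_prod: "semiring_hom h \<Longrightarrow> h (prod g S) = (\<Prod>i\<in>S. h (g i))"
  by (induction S rule: infinite_finite_induct) (auto simp: semiring_hom_def)

lemma semiring_hom_diff:
  fixes h :: "'a::comm_ring_1 \<Rightarrow> 'b::comm_ring_1"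
  assumes "semiring_hom h"
  shows "h (a - b) = h a - h b"
proof -
  have "h (a - b) + h b = h (a - b + b)" using assms unfolding semiring_hom_def by metis
  thus ?thesis by (simp add: algebra_simps)
qed

lemma semiring_hom_comp: "semiring_hom g \<Longrightarrow> semiring_hom h \<Longrightarrow> semiring_hom (\<lambda>x. g (h x))"
  by (auto simp: semiring_hom_def)

section \<open>Substitution as a ring homomorphism\<close>

lemma poly_mapping_eq_sum_single:
  "(p :: 'b \<Rightarrow>\<^sub>0 'c::comm_monoid_add) = (\<Sum>\<mu>\<in>Poly_Mapping.keys p. Poly_Mapping.single \<mu> (Poly_Mapping.lookup p \<mu>))"
  by (rule poly_mapping_eqI) (auto simp: lookup_sum lookup_single when_def in_keys_iff)

definition monomial_value :: "(nat \<Rightarrow> 'b::comm_semiring_1) \<Rightarrow> (nat \<Rightarrow>\<^sub>0 nat) \<Rightarrow> 'b" where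
  "monomial_value x \<mu> = (\<Prod>i\<in>Poly_Mapping.keys \<mu>. x i ^ Poly_Mapping.lookup \<mu> i)"

text \<open>Indices outside the support contribute \<open>x i ^ 0 = 1\<close>, so two monomials can
  be compared over one common index set.\<close>

lemma monomial_value_superset:
  assumes "finite S" "Poly_Mapping.keys \<mu> \<subseteq> S"
  shows "monomial_value x \<mu> = (\<Prod>i\<in>S. x i ^ Poly_Mapping.lookup \<mu> i)"
  unfolding monomial_value_def
  by (rule prod.mono_neutral_left) (use assms in \<open>auto simp: in_keys_iff\<close>)

lemma monomial_value_add: "monomial_value x (\<mu> + \<nu>) = monomial_value x \<mu> * monomial_value x \<nu>"
proof -
  let ?S = "Poly_Mapping.keys \<mu> \<union> Poly_Mapping.keys \<nu>"
  have "monomial_value x (\<mu> + \<nu>) = (\<Prod>i\<in>?S. x i ^ Poly_Mapping.lookup (\<mu> + \<nu>) i)"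
    by (rule monomial_value_superset) (auto simp: Poly_Mapping.keys_add)
  also have "\<dots> = (\<Prod>i\<in>?S. x i ^ Poly_Mapping.lookup \<mu> i) * (\<Prod>i\<in>?S. x i ^ Poly_Mapping.lookup \<nu> i)"
    by (simp add: lookup_add power_add prod.distrib)
  also have "\<dots> = monomial_value x \<mu> * monomial_value x \<nu>"
    by (simp add: monomial_value_superset[of ?S])
  finally show ?thesis .
qed

lemma substitute_superset:
  assumes "finite S" "Poly_Mapping.keys p \<subseteq> S" "h 0 = 0"
  shows "substitute h x p = (\<Sum>\<mu>\<in>S. h (Poly_Mapping.lookup p \<mu>) * monomial_value x \<mu>)"
  unfolding substitute_def monomial_value_def
  by (rule sum.mono_neutral_left) (use assms in \<open>auto simp: in_keys_iff\<close>)

lemma substitute_add: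
  assumes "semiring_hom h"
  shows "substitute h x (p + q) = substitute h x p + substitute h x q"
proof -
  let ?S = "Poly_Mapping.keys p \<union> Poly_Mapping.keys q"
  have h0: "h 0 = 0" and ha: "\<And>a b. h (a + b) = h a + h b" using assms by (auto simp: semiring_hom_def)
  have "substitute h x (p + q) = (\<Sum>\<mu>\<in>?S. h (Poly_Mapping.lookup (p+q) \<mu>) * monomial_value x \<mu>)"
    by (rule substitute_superset) (auto simp: Poly_Mapping.keys_add h0)
  also have "\<dots> = (\<Sum>\<mu>\<in>?S. h (Poly_Mapping.lookup p \<mu>) * monomial_value x \<mu>)
     + (\<Sum>\<mu>\<in>?S. h (Poly_Mapping.lookup q \<mu>) * monomial_value x \<mu>)"
    by (simp add: lookup_add ha distrib_right sum.distrib)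
  also have "\<dots> = substitute h x p + substitute h x q"
    by (simp add: substitute_superset[of ?S _ h, OF _ _ h0])
  finally show ?thesis .
qed

lemma substitute_single:
  assumes "semiring_hom h"
  shows "substitute h x (Poly_Mapping.single \<mu> c) = h c * monomial_value x \<mu>"
  using assms substitute_superset[of "{\<mu>}" "Poly_Mapping.single \<mu> c" h x] by (simp add: semiring_hom_def)

lemma substitute_sum:
  assumes "semiring_hom h"
  shows "substitute h x (sum g S) = (\<Sum>i\<in>S. substitute h x (g i))"
proof -
  have "substitute h x 0 = 0" by (simp add: substitute_def)
  thus ?thesis
    by (induction S rule: infinite_finite_induct) (auto simp: substitute_add[OF assms])
qed

lemma semiring_hom_substitute:
  assumes "semiring_hom h"
  shows "semiring_hom (substitute h x)"
  unfolding semiring_hom_def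
proof (intro conjI allI)
  show "substitute h x 0 = 0" by (simp add: substitute_def)
  have "substitute h x (Poly_Mapping.single 0 1) = h 1 * monomial_value x 0"
    by (rule substitute_single[OF assms])
  thus "substitute h x 1 = 1"
    using assms by (simp add: monomial_value_def semiring_hom_def)
  fix p q
  show "substitute h x (p + q) = substitute h x p + substitute h x q"
    by (rule substitute_add[OF assms])
  have hm: "\<And>a b. h (a * b) = h a * h b" using assms by (auto simp: semiring_hom_def)
  let ?t = "\<lambda>p \<mu>. Poly_Mapping.single \<mu> (Poly_Mapping.lookup p \<mu>)"
  \<comment> \<open>Both sides are biadditive in \<open>p\<close> and \<open>q\<close>; this reduces
    the product rule to single terms, where it is \<open>monomial_value_add\<close>.\<close>
  have "substitute h x (p * q) = substitute h x
     ((\<Sum>\<mu>\<in>Poly_Mapping.keys p. ?t p \<mu>) * (\<Sum>\<nu>\<in>Poly_Mapping.keys q. ?t q \<nu>))"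
    by (simp flip: poly_mapping_eq_sum_single)
  also have "\<dots> = (\<Sum>\<mu>\<in>Poly_Mapping.keys p. \<Sum>\<nu>\<in>Poly_Mapping.keys q.
      substitute h x (?t p \<mu>) * substitute h x (?t q \<nu>))"
    by (simp add: sum_product substitute_sum[OF assms] mult_single substitute_single[OF assms]
        monomial_value_add hm mult_ac)
  also have "\<dots> = substitute h x (\<Sum>\<mu>\<in>Poly_Mapping.keys p. ?t p \<mu>) * substitute h x (\<Sum>\<nu>\<in>Poly_Mapping.keys q. ?t q \<nu>)"
    by (simp add: sum_product substitute_sum[OF assms])
  also have "\<dots> = substitute h x p * substitute h x q"
    by (simp flip: poly_mapping_eq_sum_single)
  finally show "substitute h x (p * q) = substitute h x p * substitute h x q" .
qed

lemma substitute_const [simp]: "semiring_hom h \<Longrightarrow> substitute h x (const_poly c) = h c"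
  by (simp add: const_poly_def substitute_single monomial_value_def)

lemma substitute_Var [simp]: "semiring_hom h \<Longrightarrow> substitute h x (Var i) = x i"
  by (simp add: Var_def substitute_single monomial_value_def semiring_hom_def)

lemma semiring_hom_id [simp]: "semiring_hom (\<lambda>c. c)"
  by (auto simp: semiring_hom_def)

lemma const_poly_0 [simp]: "const_poly 0 = 0"
  and const_poly_1 [simp]: "const_poly 1 = 1"
  by (auto simp: const_poly_def)

lemma const_poly_add: "const_poly (a + b) = const_poly a + const_poly b"
  and const_poly_mult: "const_poly (a * b) = const_poly a * const_poly b"
  by (auto simp: const_poly_def single_add mult_single)

lemma const_poly_diff: "const_poly (a - b :: 'a::comm_ring_1) = const_poly a - const_poly b"
  by (simp add: const_poly_def single_diff)

lemma semiring_hom_const [simp]: "semiring_hom const_poly"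
  by (auto simp: semiring_hom_def const_poly_add const_poly_mult)

lemma const_poly_eq_0_iff [simp]: "const_poly c = 0 \<longleftrightarrow> c = 0"
proof
  assume "const_poly c = 0"
  hence "Poly_Mapping.lookup (const_poly c) 0 = 0" by simp
  thus "c = 0" by (simp add: const_poly_def)
qed simp

lemma semiring_hom_eval: "semiring_hom (eval_poly a)"
  using semiring_hom_substitute[OF semiring_hom_id, of a] by (simp add: eval_poly_def[abs_def])

lemma semiring_hom_compose: "semiring_hom (compose_poly f)"
  using semiring_hom_substitute[OF semiring_hom_const, of f] by (simp add: compose_poly_def[abs_def])

lemma eval_0 [simp]: "eval_poly a 0 = 0"
  and eval_1 [simp]: "eval_poly a 1 = 1"
  and eval_add [simp]: "eval_poly a (p + q) = eval_poly a p + eval_poly a q"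
  and eval_mult [simp]: "eval_poly a (p * q) = eval_poly a p * eval_poly a q"
  using semiring_hom_eval[of a] by (auto simp: semiring_hom_def)

lemma eval_const [simp]: "eval_poly a (const_poly c) = c"
  and eval_Var [simp]: "eval_poly a (Var i) = a i"
  by (auto simp: eval_poly_def)

lemmas eval_power [simp] = semiring_hom_power[OF semiring_hom_eval]
lemmas eval_sum = semiring_hom_sum[OF semiring_hom_eval]
lemmas eval_prod = semiring_hom_prod[OF semiring_hom_eval]

lemma eval_diff [simp]: "eval_poly a (p - q :: 'a::comm_ring_1 mpoly) = eval_poly a p - eval_poly a q"
  by (rule semiring_hom_diff[OF semiring_hom_eval])

lemma compose_0 [simp]: "compose_poly f 0 = 0"
  and compose_1 [simp]: "compose_poly f 1 = 1"
  and compose_add [simp]: "compose_poly f (p + q) = compose_poly f p + compose_poly f q"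
  and compose_mult [simp]: "compose_poly f (p * q) = compose_poly f p * compose_poly f q"
  using semiring_hom_compose[of f] by (auto simp: semiring_hom_def)

lemma compose_const [simp]: "compose_poly f (const_poly c) = const_poly c"
  and compose_Var [simp]: "compose_poly f (Var i) = f i"
  by (auto simp: compose_poly_def)

lemmas compose_power [simp] = semiring_hom_power[OF semiring_hom_compose]
lemmas compose_prod = semiring_hom_prod[OF semiring_hom_compose]

section \<open>The subrings \<open>polys_in V\<close> and induction on polynomials\<close>

lemma polys_in_mono: "V \<subseteq> W \<Longrightarrow> p \<in> polys_in V \<Longrightarrow> p \<in> polys_in W"
  by (auto simp: polys_in_def)

lemma const_in_polys [simp]: "const_poly c \<in> polys_in V"
  by (auto simp: polys_in_def const_poly_def)

lemma Var_in_polys [simp]: "i \<in> V \<Longrightarrow> Var i \<in> polys_in V"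
  by (auto simp: polys_in_def Var_def)

lemma zero_in_polys [simp]: "0 \<in> polys_in V"
  by (auto simp: polys_in_def)

lemma one_in_polys [simp]: "1 \<in> polys_in V"
  by (metis const_in_polys const_poly_1)

lemma add_in_polys [intro]: "p \<in> polys_in V \<Longrightarrow> q \<in> polys_in V \<Longrightarrow> p + q \<in> polys_in V"
  using Poly_Mapping.keys_add[of p q] by (fastforce simp: polys_in_def)

lemma mult_in_polys [intro]:
  assumes "p \<in> polys_in V" "q \<in> polys_in V"
  shows "p * q \<in> polys_in V"
  unfolding polys_in_def
proof safe
  fix \<mu> i assume "\<mu> \<in> Poly_Mapping.keys (p * q)" "i \<in> Poly_Mapping.keys \<mu>"
  then obtain \<alpha> \<beta> where "\<mu> = \<alpha> + \<beta>" "\<alpha> \<in> Poly_Mapping.keys p" "\<beta> \<in> Poly_Mapping.keys q"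
    using Poly_Mapping.keys_mult[of p q] by blast
  thus "i \<in> V"
    using \<open>i \<in> Poly_Mapping.keys \<mu>\<close> Poly_Mapping.keys_add[of \<alpha> \<beta>] assms by (auto simp: polys_in_def)
qed

lemma power_in_polys [intro]: "p \<in> polys_in V \<Longrightarrow> p ^ n \<in> polys_in V"
  by (induction n) auto

lemma sum_in_polys [intro]: "(\<And>i. i \<in> S \<Longrightarrow> g i \<in> polys_in V) \<Longrightarrow> sum g S \<in> polys_in V"
  by (induction S rule: infinite_finite_induct) auto

lemma prod_in_polys [intro]: "(\<And>i. i \<in> S \<Longrightarrow> g i \<in> polys_in V) \<Longrightarrow> prod g S \<in> polys_in V"
  by (induction S rule: infinite_finite_induct) auto

lemma diff_in_polys [intro]:
  fixes p q :: "'a::comm_ring_1 mpoly"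
  assumes "p \<in> polys_in V" "q \<in> polys_in V"
  shows "p - q \<in> polys_in V"
proof -
  have "p - q = p + const_poly (0 - 1) * q" unfolding const_poly_diff by simp
  also have "\<dots> \<in> polys_in V" using assms by (intro add_in_polys mult_in_polys) auto
  finally show ?thesis .
qed

lemma Var_power_eq_single: "(Var i :: 'a::comm_semiring_1 mpoly) ^ n = Poly_Mapping.single (Poly_Mapping.single i n) 1"
proof (induction n)
  case (Suc n)
  have "Poly_Mapping.single i (Suc n) = Poly_Mapping.single i 1 + Poly_Mapping.single i n"
    by (simp flip: single_add)
  thus ?case using Suc by (simp add: Var_def mult_single)
qed simp

lemma prod_single: "(\<Prod>i\<in>S. Poly_Mapping.single (\<nu> i) (1::'a::comm_semiring_1)) =
    Poly_Mapping.single (\<Sum>i\<in>S. \<nu> i :: nat \<Rightarrow>\<^sub>0 nat) 1"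
  by (induction S rule: infinite_finite_induct) (auto simp: mult_single)

lemma single_eq_monomial:
  "Poly_Mapping.single \<mu> c = const_poly c * (\<Prod>i\<in>Poly_Mapping.keys \<mu>. Var i ^ Poly_Mapping.lookup \<mu> i)"
  by (simp add: Var_power_eq_single prod_single const_poly_def mult_single flip: poly_mapping_eq_sum_single)

text \<open>Each polynomial is a finite sum of products of constants and variables. The principle
  keeps exponent vectors out of most later proofs.\<close>

lemma polys_in_induct [consumes 1, case_names const Var add mult]:
  assumes p: "p \<in> polys_in V"
    and c: "\<And>c. P (const_poly c)" and v: "\<And>i. i \<in> V \<Longrightarrow> P (Var i)"
    and a: "\<And>p q. p \<in> polys_in V \<Longrightarrow> q \<in> polys_in V \<Longrightarrow> P p \<Longrightarrow> P q \<Longrightarrow> P (p + q)"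
    and m: "\<And>p q. p \<in> polys_in V \<Longrightarrow> q \<in> polys_in V \<Longrightarrow> P p \<Longrightarrow> P q \<Longrightarrow> P (p * q)"
  shows "P p"
proof -
  have c': "P 0" "P 1" using c[of 0] c[of 1] by auto
  have sums: "(\<And>i. i \<in> S \<Longrightarrow> P (g i) \<and> g i \<in> polys_in V) \<Longrightarrow> P (sum g S)" for S and g :: "(nat \<Rightarrow>\<^sub>0 nat) \<Rightarrow> 'a mpoly"
    by (induction S rule: infinite_finite_induct) (auto intro: a c')
  have prods: "(\<And>i. i \<in> S \<Longrightarrow> P (g i) \<and> g i \<in> polys_in V) \<Longrightarrow> P (prod g S)" for S and g :: "nat \<Rightarrow> 'a mpoly"
    by (induction S rule: infinite_finite_induct) (auto intro: m c')
  have pows: "P (q ^ n)" if "P q" "q \<in> polys_in V" for q n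
    by (induction n) (auto intro: that m c')
  have "P (\<Sum>\<mu>\<in>Poly_Mapping.keys p. Poly_Mapping.single \<mu> (Poly_Mapping.lookup p \<mu>))"
  proof (rule sums)
    fix \<mu> assume "\<mu> \<in> Poly_Mapping.keys p"
    hence i: "i \<in> V" if "i \<in> Poly_Mapping.keys \<mu>" for i using p that by (auto simp: polys_in_def)
    have "P (\<Prod>i\<in>Poly_Mapping.keys \<mu>. Var i ^ Poly_Mapping.lookup \<mu> i)"
      by (rule prods) (auto intro!: pows v power_in_polys dest: i)
    thus "P (Poly_Mapping.single \<mu> (Poly_Mapping.lookup p \<mu>)) \<and>
        Poly_Mapping.single \<mu> (Poly_Mapping.lookup p \<mu>) \<in> polys_in V"
      unfolding single_eq_monomial using i by (intro conjI m c mult_in_polys prod_in_polys power_in_polys) auto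
  qed
  thus ?thesis by (simp flip: poly_mapping_eq_sum_single)
qed

lemma polys_in_UNIV [simp]: "p \<in> polys_in UNIV"
  by (simp add: polys_in_def)

text \<open>The uniqueness half of the universal property of the polynomial ring;
  \<open>UNIV\<close> for \<open>V\<close> covers the whole type.\<close>

lemma hom_eq_on_polys:
  assumes "semiring_hom g" "semiring_hom h" "p \<in> polys_in V"
    and "\<And>c. g (const_poly c) = h (const_poly c)" and "\<And>i. i \<in> V \<Longrightarrow> g (Var i) = h (Var i)"
  shows "g p = h p"
  using assms(3) by (induction rule: polys_in_induct) (use assms in \<open>auto simp: semiring_hom_def\<close>)

lemma eval_cong: "p \<in> polys_in V \<Longrightarrow> (\<And>i. i \<in> V \<Longrightarrow> a i = b i) \<Longrightarrow> eval_poly a p = eval_poly b p"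
  by (rule hom_eq_on_polys) (auto simp: semiring_hom_eval)

lemma eval_compose: "eval_poly a (compose_poly f p) = eval_poly (\<lambda>i. eval_poly a (f i)) p"
  by (rule hom_eq_on_polys[where V = UNIV]) (auto intro: semiring_hom_comp semiring_hom_eval semiring_hom_compose)

lemma compose_in_polys:
  assumes "p \<in> polys_in W" "\<And>i. i \<in> W \<Longrightarrow> f i \<in> polys_in V"
  shows "compose_poly f p \<in> polys_in V"
  using assms(1) by (induction rule: polys_in_induct) (auto simp: assms(2))

text \<open>The image of composition is a subalgebra, and by induction on polynomials it lies in
  every subalgebra that contains the generators. Membership in the generated algebra thus becomes
  the existence of some \<open>s\<close> with \<open>g = compose_poly f s\<close>.\<close>

lemma generated_subalgebra_eq: "generated_subalgebra (f ` V) = compose_poly f ` polys_in V"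
  unfolding generated_subalgebra_def
proof (rule hull_unique)
  show "f ` V \<subseteq> compose_poly f ` polys_in V"
    using compose_Var[of f] by (metis Var_in_polys image_iff image_subsetI)
  show "is_subalgebra (compose_poly f ` polys_in V)"
    unfolding is_subalgebra_def
  proof (intro conjI ballI)
    show "range const_poly \<subseteq> compose_poly f ` polys_in V"
      using compose_const[of f] by (metis const_in_polys image_iff image_subsetI)
    fix p q assume "p \<in> compose_poly f ` polys_in V" "q \<in> compose_poly f ` polys_in V"
    then obtain p' q' where "p' \<in> polys_in V" "q' \<in> polys_in V" "p = compose_poly f p'" "q = compose_poly f q'"
      by auto
    moreover have "compose_poly f (p' + q') = compose_poly f p' + compose_poly f q'"
      "compose_poly f (p' * q') = compose_poly f p' * compose_poly f q'" by auto
    ultimately show "p + q \<in> compose_poly f ` polys_in V" "p * q \<in> compose_poly f ` polys_in V"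
      by (metis add_in_polys mult_in_polys image_iff)+
  qed
next
  fix S :: "'a mpoly set" assume S: "f ` V \<subseteq> S" "is_subalgebra S"
  have "compose_poly f p \<in> S" if "p \<in> polys_in V" for p
    using that by (induction rule: polys_in_induct) (use S in \<open>auto simp: is_subalgebra_def\<close>)
  thus "compose_poly f ` polys_in V \<subseteq> S" by auto
qed

section \<open>Polynomials in one distinguished variable\<close>

text \<open>The isomorphism that isolates the variable \<open>j\<close>, with inverse
  \<open>\<lambda>P. poly P (Var j)\<close>. The coefficient type still contains that variable, so
  \<open>polys_over\<close> has to record which variables the coefficients may use.\<close>

definition uni :: "nat \<Rightarrow> 'a::comm_semiring_1 mpoly \<Rightarrow> 'a mpoly poly" where
  "uni j = substitute (\<lambda>c. [:const_poly c:]) (\<lambda>i. if i = j then [:0, 1:] else [:Var i:])"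

definition polys_over :: "nat set \<Rightarrow> 'a::comm_semiring_1 mpoly poly set" where
  "polys_over V = {P. \<forall>i. coeff P i \<in> polys_in V}"

definition specialise :: "(nat \<Rightarrow> 'a::comm_semiring_1) \<Rightarrow> 'a mpoly poly \<Rightarrow> 'a poly" where
  "specialise a = map_poly (eval_poly a)"

lemma coeff_in_polys [intro]: "P \<in> polys_over V \<Longrightarrow> coeff P i \<in> polys_in V"
  by (simp add: polys_over_def)

lemma zero_over [simp]: "0 \<in> polys_over V"
  and add_over [intro]: "P \<in> polys_over V \<Longrightarrow> Q \<in> polys_over V \<Longrightarrow> P + Q \<in> polys_over V"
  and mult_over [intro]: "P \<in> polys_over V \<Longrightarrow> Q \<in> polys_over V \<Longrightarrow> P * Q \<in> polys_over V"
  and smult_over [intro]: "c \<in> polys_in V \<Longrightarrow> P \<in> polys_over V \<Longrightarrow> smult c P \<in> polys_over V"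
  and monom_over [intro]: "c \<in> polys_in V \<Longrightarrow> monom c n \<in> polys_over V"
  by (auto simp: polys_over_def coeff_mult)

lemma pCons_over: "pCons c P \<in> polys_over V \<longleftrightarrow> c \<in> polys_in V \<and> P \<in> polys_over V"
  unfolding polys_over_def mem_Collect_eq by (metis coeff_pCons_0 coeff_pCons_Suc not0_implies_Suc)

lemma one_over [simp]: "1 \<in> polys_over V"
  by (simp add: one_pCons pCons_over)

lemma diff_over [intro]:
  "P \<in> polys_over V \<Longrightarrow> Q \<in> polys_over V \<Longrightarrow> P - Q \<in> polys_over (V :: nat set)" for P :: "'a::comm_ring_1 mpoly poly"
  by (auto simp: polys_over_def)

lemma power_over [intro]: "P \<in> polys_over V \<Longrightarrow> P ^ n \<in> polys_over V"
  by (induction n) auto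

lemma coeff_specialise [simp]: "coeff (specialise a P) i = eval_poly a (coeff P i)"
  by (simp add: specialise_def coeff_map_poly)

lemma specialise_0 [simp]: "specialise a 0 = 0"
  and specialise_1 [simp]: "specialise a 1 = 1"
  and specialise_add [simp]: "specialise a (P + Q) = specialise a P + specialise a Q"
  and specialise_mult [simp]: "specialise a (P * Q) = specialise a P * specialise a Q"
  and specialise_smult [simp]: "specialise a (smult c P) = smult (eval_poly a c) (specialise a P)"
  and specialise_pCons [simp]: "specialise a (pCons c P) = pCons (eval_poly a c) (specialise a P)"
  by (auto simp: poly_eq_iff coeff_mult eval_sum coeff_pCons split: nat.splits)

lemma semiring_hom_specialise: "semiring_hom (specialise a)"
  by (simp add: semiring_hom_def)

lemma specialise_diff [simp]: "specialise a (P - Q) = specialise a P - specialise a Q" for P :: "'a::comm_ring_1 mpoly poly"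
  by (auto simp: poly_eq_iff)

lemmas specialise_power [simp] = semiring_hom_power[OF semiring_hom_specialise]

lemma degree_specialise_le: "degree (specialise a P) \<le> degree P"
  by (rule degree_le) (auto simp: coeff_eq_0)

lemma degree_specialise_eq: "eval_poly a (lead_coeff P) \<noteq> 0 \<Longrightarrow> degree (specialise a P) = degree P"
  by (metis antisym coeff_specialise degree_specialise_le le_degree)

lemma specialise_cong:
  "P \<in> polys_over V \<Longrightarrow> (\<And>i. i \<in> V \<Longrightarrow> a i = b i) \<Longrightarrow> specialise a P = specialise b P"
  by (auto simp: poly_eq_iff intro!: eval_cong[of _ V])

lemma specialise_upd: "P \<in> polys_over V \<Longrightarrow> j \<notin> V \<Longrightarrow> specialise (a(j := y)) P = specialise a P"
  by (rule specialise_cong) auto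

lemma eval_upd: "p \<in> polys_in V \<Longrightarrow> j \<notin> V \<Longrightarrow> eval_poly (a(j := y)) p = eval_poly a p"
  by (rule eval_cong) auto

lemma semiring_hom_const_pCons: "semiring_hom (\<lambda>c. [:const_poly c:])"
  by (simp add: semiring_hom_def const_poly_add const_poly_mult one_pCons mult.commute)

lemma semiring_hom_uni: "semiring_hom (uni j)"
  unfolding uni_def by (rule semiring_hom_substitute[OF semiring_hom_const_pCons])

lemma uni_0 [simp]: "uni j 0 = 0"
  and uni_1 [simp]: "uni j 1 = 1"
  and uni_add [simp]: "uni j (p + q) = uni j p + uni j q"
  and uni_mult [simp]: "uni j (p * q) = uni j p * uni j q"
  using semiring_hom_uni[of j] by (auto simp: semiring_hom_def)

lemma uni_const [simp]: "uni j (const_poly c) = [:const_poly c:]"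
  and uni_Var: "uni j (Var i) = (if i = j then [:0, 1:] else [:Var i:])"
  by (auto simp: uni_def substitute_const[OF semiring_hom_const_pCons] substitute_Var[OF semiring_hom_const_pCons])

lemma uni_over: "p \<in> polys_in (insert j V) \<Longrightarrow> uni j p \<in> polys_over V"
  by (induction rule: polys_in_induct) (auto simp: pCons_over uni_Var)

lemma uni_free: "p \<in> polys_in V \<Longrightarrow> j \<notin> V \<Longrightarrow> uni j p = [:p:]"
  by (induction rule: polys_in_induct) (auto simp: uni_Var mult.commute)

lemma poly_uni [simp]: "poly (uni j p) (Var j) = p"
  by (rule hom_eq_on_polys[of "\<lambda>p. poly (uni j p) (Var j)" "\<lambda>p. p" p UNIV])
     (auto simp: uni_Var semiring_hom_def)

lemma poly_in_polys: "P \<in> polys_over V \<Longrightarrow> poly P (Var j) \<in> polys_in (insert j V)"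
  by (induction P) (auto simp: pCons_over intro!: add_in_polys mult_in_polys intro: polys_in_mono[of V])

lemma uni_poly: "P \<in> polys_over V \<Longrightarrow> j \<notin> V \<Longrightarrow> uni j (poly P (Var j)) = P"
  by (induction P) (auto simp: pCons_over uni_free uni_Var)

lemma uni_eq_0_iff [simp]: "uni j p = 0 \<longleftrightarrow> p = 0"
  by (metis poly_uni uni_0 poly_0)

text \<open>Restriction to the line through \<open>a\<close> parallel to the \<open>j\<close>-th
  axis; through this identity univariate facts act on polynomials in several variables.\<close>

lemma poly_specialise_uni: "poly (specialise a (uni j p)) y = eval_poly (a(j := y)) p"
  by (rule hom_eq_on_polys[of "\<lambda>p. poly (specialise a (uni j p)) y" _ p UNIV])
     (auto simp: uni_Var semiring_hom_eval, auto simp: semiring_hom_def)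

lemma poly_specialise_uni' [simp]: "poly (specialise a (uni j p)) (a j) = eval_poly a p"
  by (simp add: poly_specialise_uni)

lemma eval_poly_poly: "eval_poly a (poly P q) = poly (specialise a P) (eval_poly a q)"
  by (induction P) auto

section \<open>Nonvanishing of nonzero polynomials at points\<close>

lemma exists_nonroot:
  fixes p :: "'a::field_char_0 poly"
  assumes "p \<noteq> 0"
  shows "\<exists>x. poly p x \<noteq> 0"
  using assms poly_all_0_iff_0 by blast

lemma const_poly_eval_empty: "p \<in> polys_in {} \<Longrightarrow> p = const_poly (eval_poly a p)"
  by (induction rule: polys_in_induct) (auto simp: const_poly_add const_poly_mult)

text \<open>Choose the other coordinates so that the leading coefficient in the variable
  \<open>j\<close> survives; what remains is a nonzero univariate polynomial over an infinite field,
  and it has a nonroot.\<close>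

lemma exists_eval_nonzero:
  fixes p :: "'a::field_char_0 mpoly"
  assumes "finite V" "p \<in> polys_in V" "p \<noteq> 0"
  shows "\<exists>a. eval_poly a p \<noteq> 0"
  using assms
proof (induction V arbitrary: p rule: finite_induct)
  case empty
  have "p = const_poly (eval_poly (\<lambda>_. 0) p)" by (rule const_poly_eval_empty[OF empty(1)])
  thus ?case using empty by (metis const_poly_0)
next
  case (insert j V)
  have "uni j p \<in> polys_over V" "uni j p \<noteq> 0" using insert.prems by (auto simp: uni_over)
  then obtain a where "eval_poly a (lead_coeff (uni j p)) \<noteq> 0"
    using insert.IH[of "lead_coeff (uni j p)"] by auto
  hence "specialise a (uni j p) \<noteq> 0" by (metis coeff_0 coeff_specialise)
  then obtain y where "poly (specialise a (uni j p)) y \<noteq> 0" using exists_nonroot by blast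
  thus ?case unfolding poly_specialise_uni by blast
qed

text \<open>Turns pointwise identities into polynomial ones; a polynomial involves only finitely
  many variables, so the previous lemma applies.\<close>

lemma eval_all_0_imp_0:
  fixes p :: "'a::field_char_0 mpoly"
  assumes "\<And>a. eval_poly a p = 0"
  shows "p = 0"
proof (rule ccontr)
  assume "p \<noteq> 0"
  moreover have "p \<in> polys_in (\<Union>\<mu>\<in>Poly_Mapping.keys p. Poly_Mapping.keys \<mu>)" by (auto simp: polys_in_def)
  ultimately show False using exists_eval_nonzero[of _ p] assms by (metis (no_types) finite_UN finite_keys)
qed

section \<open>Pseudo-division and common divisors\<close>

definition psize :: "'a::zero poly \<Rightarrow> nat" where
  "psize P = (if P = 0 then 0 else Suc (degree P))"

lemma psize_less:
  assumes "P \<noteq> 0" "\<And>i. i \<ge> degree P \<Longrightarrow> coeff Q i = 0"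
  shows "psize Q < psize P"
  using assms by (auto simp: psize_def) (metis leading_coeff_0_iff linorder_not_le)

text \<open>The leading coefficient of \<open>G\<close> has no inverse in general, so
  \<open>P\<close> is multiplied by it before each cancellation of a leading term. The measure
  \<open>psize\<close> ranks the zero polynomial below nonzero constants, so it also describes the
  remainder when \<open>G\<close> is constant.\<close>

lemma pseudo_division:
  fixes P G :: "'a::field mpoly poly"
  assumes "P \<in> polys_over V" "G \<in> polys_over V" "G \<noteq> 0"
  shows "\<exists>e S R. S \<in> polys_over V \<and> R \<in> polys_over V \<and> smult (lead_coeff G ^ e) P = G * S + R \<and> psize R < psize G"
  using assms(1)
proof (induction "psize P" arbitrary: P rule: less_induct)
  case less
  show ?case
  proof (cases "psize P < psize G")
    case True
    hence "smult (lead_coeff G ^ 0) P = G * 0 + P" by simp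
    thus ?thesis using True less.prems zero_over by blast
  next
    case False
    hence P: "P \<noteq> 0" "degree G \<le> degree P" using assms(3) by (auto simp: psize_def split: if_splits)
    define T where "T = monom (lead_coeff P) (degree P - degree G)"
    define P1 where "P1 = smult (lead_coeff G) P - T * G"
    have T: "T \<in> polys_over V" using less.prems by (auto simp: T_def)
    hence P1: "P1 \<in> polys_over V" unfolding P1_def using less.prems assms by auto
    have "psize P1 < psize P"
    proof (rule psize_less[OF P(1)])
      fix i assume "i \<ge> degree P"
      thus "coeff P1 i = 0" using P(2)
        by (cases "i = degree P") (auto simp: P1_def T_def coeff_monom_mult coeff_eq_0)
    qed
    from less.hyps[OF this P1] obtain e S R where
      *: "S \<in> polys_over V" "R \<in> polys_over V" "smult (lead_coeff G ^ e) P1 = G * S + R" "psize R < psize G" by blast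
    have "smult (lead_coeff G ^ Suc e) P = G * (S + smult (lead_coeff G ^ e) T) + R"
      using *(3) unfolding P1_def by (simp add: algebra_simps smult_diff_right)
    thus ?thesis using * T assms(2) by (meson add_over smult_over power_in_polys coeff_in_polys)
  qed
qed

text \<open>Over the fraction field of the coefficients the ideal \<open>J\<close> would be
  principal. Here an element of least degree generates it up to powers of its leading coefficient,
  because pseudo-remainders stay in \<open>J\<close> and are too small to be nonzero.\<close>

lemma exists_generator:
  fixes J :: "'a::field mpoly poly set"
  assumes J: "J \<subseteq> polys_over V" "\<exists>P\<in>J. P \<noteq> 0"
    and diff: "\<And>P Q. P \<in> J \<Longrightarrow> Q \<in> J \<Longrightarrow> P - Q \<in> J"
    and mult: "\<And>P Q. P \<in> J \<Longrightarrow> Q \<in> polys_over V \<Longrightarrow> P * Q \<in> J"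
  obtains G where "G \<in> J" "G \<noteq> 0" "\<And>P. P \<in> J \<Longrightarrow> P \<noteq> 0 \<Longrightarrow> degree G \<le> degree P"
    "\<And>P. P \<in> J \<Longrightarrow> \<exists>e. \<exists>S\<in>polys_over V. smult (lead_coeff G ^ e) P = G * S"
proof -
  obtain G where G: "G \<in> J" "G \<noteq> 0" and min: "\<And>P. P \<in> J \<Longrightarrow> P \<noteq> 0 \<Longrightarrow> degree G \<le> degree P"
    using J(2) arg_min_nat_lemma[of "\<lambda>P. P \<in> J \<and> P \<noteq> 0" _ degree] by blast
  have "\<exists>e. \<exists>S\<in>polys_over V. smult (lead_coeff G ^ e) P = G * S" if P: "P \<in> J" for P
  proof -
    obtain e S R where *: "S \<in> polys_over V" "smult (lead_coeff G ^ e) P = G * S + R" "psize R < psize G"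
      using pseudo_division[of P V G] P G J(1) by blast
    have "P * [:lead_coeff G ^ e:] - G * S \<in> J"
      by (intro diff mult P G *) (use G J in \<open>auto simp: pCons_over\<close>)
    moreover have "P * [:lead_coeff G ^ e:] - G * S = R" using *(2) by simp
    ultimately have "R = 0" using min[of R] *(3) by (auto simp: psize_def split: if_splits)
    thus ?thesis using * by auto
  qed
  thus ?thesis using that G min by blast
qed

text \<open>Applied to the ideal of all combinations of \<open>P\<close> and \<open>Q\<close>,
  \<open>exists_generator\<close> yields their greatest common divisor over the fraction field, with
  denominators cleared, together with a Bezout identity.\<close>

lemma exists_common_divisor:
  fixes P Q :: "'a::field mpoly poly"
  assumes "P \<in> polys_over V" "Q \<in> polys_over V" "P \<noteq> 0 \<or> Q \<noteq> 0"
  obtains v A B e P' e' Q' where "v \<in> polys_over V" "v \<noteq> 0" "v = P * A + Q * B"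
    "P' \<in> polys_over V" "smult (lead_coeff v ^ e) P = v * P'"
    "Q' \<in> polys_over V" "smult (lead_coeff v ^ e') Q = v * Q'"
proof -
  define I where "I = {P * A + Q * B |A B. A \<in> polys_over V \<and> B \<in> polys_over V}"
  have PI: "P \<in> I" unfolding I_def by (intro CollectI exI[of _ 1] exI[of _ 0]) auto
  have QI: "Q \<in> I" unfolding I_def by (intro CollectI exI[of _ 0] exI[of _ 1]) auto
  have IV: "I \<subseteq> polys_over V" using assms by (auto simp: I_def)
  have I_diff: "F - G \<in> I" if FG: "F \<in> I" "G \<in> I" for F G
  proof -
    from FG obtain A B A' B' where *: "A \<in> polys_over V" "B \<in> polys_over V" "A' \<in> polys_over V" "B' \<in> polys_over V"
      "F = P * A + Q * B" "G = P * A' + Q * B'" unfolding I_def by blast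
    have "F - G = P * (A - A') + Q * (B - B')" by (simp add: * algebra_simps)
    thus ?thesis unfolding I_def using * by blast
  qed
  have I_mult: "F * G \<in> I" if FG: "F \<in> I" "G \<in> polys_over V" for F G
  proof -
    from FG obtain A B where *: "A \<in> polys_over V" "B \<in> polys_over V" "F = P * A + Q * B"
      unfolding I_def by blast
    have "F * G = P * (A * G) + Q * (B * G)" by (simp add: * algebra_simps)
    thus ?thesis unfolding I_def using * FG(2) by blast
  qed
  obtain v where v: "v \<in> I" "v \<noteq> 0"
    and gen: "\<And>F. F \<in> I \<Longrightarrow> \<exists>e. \<exists>S\<in>polys_over V. smult (lead_coeff v ^ e) F = v * S"
    using exists_generator[OF IV _ I_diff I_mult] assms(3) PI QI by metis
  obtain A B where "v = P * A + Q * B" using v unfolding I_def by blast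
  thus thesis using that v IV gen[OF PI] gen[OF QI] by blast
qed

section \<open>Roots over an algebraically closed field\<close>

lemma dvd_power_degree:
  fixes p q :: "'a::alg_closed_field poly"
  assumes "p \<noteq> 0" "\<And>y. poly p y = 0 \<Longrightarrow> poly q y = 0"
  shows "p dvd q ^ degree p"
  using assms
proof (induction "degree p" arbitrary: p)
  case 0
  thus ?case by (metis dvd_0_left_iff is_unit_iff_degree unit_imp_dvd)
next
  case (Suc d)
  then obtain c where c: "poly p c = 0" using alg_closed_imp_poly_has_root[of p] by auto
  then obtain p1 where p1: "p = [:-c, 1:] * p1" by (auto simp: poly_eq_0_iff_dvd)
  have nz: "p1 \<noteq> 0" using p1 Suc.prems by auto
  have "degree p = Suc (degree p1)" unfolding p1 using nz by (subst degree_mult_eq) auto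
  moreover have "p1 dvd q ^ degree p1"
    using Suc nz calculation p1 by (intro Suc.hyps(1)) auto
  \<comment> \<open>One copy of \<open>q\<close> pays for each linear factor split off from
    \<open>p\<close>, so \<open>degree p\<close> copies are enough.\<close>
  moreover have "[:-c, 1:] dvd q" using Suc.prems c by (auto simp flip: poly_eq_0_iff_dvd)
  ultimately show ?case unfolding p1 by (metis mult_dvd_mono power_Suc)
qed

text \<open>Such a \<open>p\<close> is \<open>lead_coeff p\<close> times the power
  \<open>Suc s\<close> of \<open>[:- c, 1:]\<close>; this compares the two highest coefficients.
  Dividing by \<open>of_nat (Suc s)\<close>, possible in characteristic 0, makes the root rational
  in the coefficients.\<close>

lemma single_root_coeff:
  fixes p :: "'a::alg_closed_field poly"
  assumes "degree p = Suc s" "\<And>y. poly p y = 0 \<Longrightarrow> y = c"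
  shows "of_nat (Suc s) * lead_coeff p * c + coeff p s = 0"
  using assms
proof (induction s arbitrary: p)
  case (0 p)
  obtain d where d: "poly p d = 0" using alg_closed_imp_poly_has_root[of p] 0(1) zero_less_Suc by metis
  hence "poly p c = 0" using 0(2)[OF d] by simp
  hence "(\<Sum>i\<le>Suc 0. coeff p i * c ^ i) = 0" using 0(1) by (simp only: poly_altdef)
  thus ?case using 0(1) by (simp add: algebra_simps)
next
  case (Suc s p)
  obtain d where d: "poly p d = 0" using alg_closed_imp_poly_has_root[of p] Suc.prems(1) zero_less_Suc by metis
  hence "poly p c = 0" using Suc.prems(2)[OF d] by simp
  then obtain p1 where p1: "p = [:-c, 1:] * p1" by (auto simp: poly_eq_0_iff_dvd)
  have nz: "p1 \<noteq> 0" using p1 Suc.prems(1) by auto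
  have "degree p = Suc (degree p1)" unfolding p1 using nz by (subst degree_mult_eq) auto
  hence deg: "degree p1 = Suc s" using Suc.prems(1) by simp
  have IH: "of_nat (Suc s) * lead_coeff p1 * c + coeff p1 s = 0"
  proof (rule Suc.IH[OF deg])
    fix y assume "poly p1 y = 0"
    thus "y = c" by (intro Suc.prems(2)) (simp add: p1)
  qed
  have "lead_coeff p = lead_coeff p1" unfolding p1 by (subst lead_coeff_mult) auto
  moreover have "coeff p (Suc s) = coeff p1 s - c * lead_coeff p1" using deg unfolding p1 by simp
  ultimately have "of_nat (Suc (Suc s)) * lead_coeff p * c + coeff p (Suc s)
      = of_nat (Suc s) * lead_coeff p1 * c + coeff p1 s"
    by (simp add: algebra_simps)
  with IH show ?case by simp
qed

section \<open>Constructible sets and Chevalley's theorem\<close>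

text \<open>A single inequation loses no generality over a domain, since several of them can be
  multiplied together.\<close>

definition locally_closed_at :: "'a::comm_semiring_1 mpoly set \<Rightarrow> 'a mpoly \<Rightarrow> (nat \<Rightarrow> 'a) \<Rightarrow> bool" where
  "locally_closed_at P q a \<longleftrightarrow> (\<forall>p\<in>P. eval_poly a p = 0) \<and> eval_poly a q \<noteq> 0"

text \<open>Sets of points are predicates on total functions; \<open>V\<close> bounds the
  coordinates on which membership depends, and elimination shrinks \<open>V\<close>.\<close>

definition constructible :: "nat set \<Rightarrow> ((nat \<Rightarrow> 'a::comm_semiring_1) \<Rightarrow> bool) \<Rightarrow> bool" where
  "constructible V S \<longleftrightarrow> (\<exists>L. finite L \<and> (\<forall>(P, q)\<in>L. finite P \<and> P \<subseteq> polys_in V \<and> q \<in> polys_in V) \<and>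
     S = (\<lambda>a. \<exists>(P, q)\<in>L. locally_closed_at P q a))"

lemma constructibleE:
  assumes "constructible V S"
  obtains L where "finite L" "\<forall>P q. (P, q) \<in> L \<longrightarrow> finite P \<and> P \<subseteq> polys_in V \<and> q \<in> polys_in V"
    "\<forall>a. S a \<longleftrightarrow> (\<exists>(P, q)\<in>L. locally_closed_at P q a)"
proof -
  from assms obtain L where "finite L" "\<forall>(P, q)\<in>L. finite P \<and> P \<subseteq> polys_in V \<and> q \<in> polys_in V"
    "S = (\<lambda>a. \<exists>(P, q)\<in>L. locally_closed_at P q a)"
    unfolding constructible_def by (elim exE conjE)
  thus ?thesis by (intro that[of L]) auto
qed

lemma constructibleI:
  assumes "finite L" "\<And>P q. (P, q) \<in> L \<Longrightarrow> finite P \<and> P \<subseteq> polys_in V \<and> q \<in> polys_in V"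
    "\<And>a. S a \<longleftrightarrow> (\<exists>(P, q)\<in>L. locally_closed_at P q a)"
  shows "constructible V S"
proof -
  have "S = (\<lambda>a. \<exists>(P, q)\<in>L. locally_closed_at P q a)" by (rule ext) (rule assms(3))
  thus ?thesis unfolding constructible_def using assms(1,2) by (intro exI[of _ L]) auto
qed

lemma constructible_locally_closed:
  "finite P \<Longrightarrow> P \<subseteq> polys_in V \<Longrightarrow> q \<in> polys_in V \<Longrightarrow> constructible V (locally_closed_at P q)"
  by (rule constructibleI[of "{(P, q)}"]) auto

lemma constructible_False: "constructible V (\<lambda>a. False)"
  by (rule constructibleI[of "{}"]) auto

lemma constructible_True: "constructible V (\<lambda>a. True)"
  by (rule constructibleI[of "{({}, 1)}"]) (auto simp: locally_closed_at_def)

lemma constructible_nonzero: "p \<in> polys_in V \<Longrightarrow> constructible V (\<lambda>a. eval_poly a p \<noteq> 0)"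
  by (rule constructibleI[of "{({}, p)}"]) (auto simp: locally_closed_at_def)

lemma constructible_zero: "p \<in> polys_in V \<Longrightarrow> constructible V (\<lambda>a. eval_poly a p = 0)"
  by (rule constructibleI[of "{({p}, 1)}"]) (auto simp: locally_closed_at_def)

lemma constructible_disj:
  assumes "constructible V S" "constructible V T"
  shows "constructible V (\<lambda>a. S a \<or> T a)"
proof -
  obtain L where L: "finite L"
    "\<forall>P q. (P, q) \<in> L \<longrightarrow> finite P \<and> P \<subseteq> polys_in V \<and> q \<in> polys_in V"
    "\<forall>a. S a \<longleftrightarrow> (\<exists>(P, q)\<in>L. locally_closed_at P q a)"
    by (rule constructibleE[OF assms(1)])
  obtain M where M: "finite M"
    "\<forall>P q. (P, q) \<in> M \<longrightarrow> finite P \<and> P \<subseteq> polys_in V \<and> q \<in> polys_in V"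
    "\<forall>a. T a \<longleftrightarrow> (\<exists>(P, q)\<in>M. locally_closed_at P q a)"
    by (rule constructibleE[OF assms(2)])
  show ?thesis
  proof (rule constructibleI[of "L \<union> M"])
    fix P q assume "(P, q) \<in> L \<union> M"
    thus "finite P \<and> P \<subseteq> polys_in V \<and> q \<in> polys_in V" using L(2) M(2) by blast
  qed (auto simp: L M)
qed

lemma constructible_conj:
  fixes S T :: "(nat \<Rightarrow> 'a::idom) \<Rightarrow> bool"
  assumes "constructible V S" "constructible V T"
  shows "constructible V (\<lambda>a. S a \<and> T a)"
proof -
  obtain L where L: "finite L"
    "\<forall>P q. (P, q) \<in> L \<longrightarrow> finite P \<and> P \<subseteq> polys_in V \<and> q \<in> polys_in V"
    "\<forall>a. S a \<longleftrightarrow> (\<exists>(P, q)\<in>L. locally_closed_at P q a)"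
    by (rule constructibleE[OF assms(1)])
  obtain M where M: "finite M"
    "\<forall>P q. (P, q) \<in> M \<longrightarrow> finite P \<and> P \<subseteq> polys_in V \<and> q \<in> polys_in V"
    "\<forall>a. T a \<longleftrightarrow> (\<exists>(P, q)\<in>M. locally_closed_at P q a)"
    by (rule constructibleE[OF assms(2)])
  have *: "locally_closed_at (P \<union> P') (q * q') a \<longleftrightarrow> locally_closed_at P q a \<and> locally_closed_at P' q' a"
    for P P' and q q' :: "'a mpoly" and a
    by (auto simp: locally_closed_at_def)
  show ?thesis
  proof (rule constructibleI[of "(\<lambda>((P, q), (P', q')). (P \<union> P', q * q')) ` (L \<times> M)"])
    fix P q assume "(P, q) \<in> (\<lambda>((P, q), (P', q')). (P \<union> P', q * q')) ` (L \<times> M)"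
    thus "finite P \<and> P \<subseteq> polys_in V \<and> q \<in> polys_in V" by (auto dest!: L(2)[rule_format] M(2)[rule_format])
  next
    fix a show "(S a \<and> T a) = (\<exists>(P, q)\<in>(\<lambda>((P, q), (P', q')). (P \<union> P', q * q')) ` (L \<times> M). locally_closed_at P q a)"
      unfolding L(3)[rule_format] M(3)[rule_format] by (auto simp: * split_beta)
  qed (use L(1) M(1) in auto)
qed

lemma constructible_bex:
  "finite I \<Longrightarrow> (\<And>i. i \<in> I \<Longrightarrow> constructible V (S i)) \<Longrightarrow> constructible V (\<lambda>a. \<exists>i\<in>I. S i a)"
  by (induction I rule: finite_induct) (auto intro: constructible_False constructible_disj)

text \<open>Induction over the finite union: the complement of one piece is given by
  \<open>q = 0\<close> or by \<open>p \<noteq> 0\<close> for some \<open>p\<close> in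
  \<open>P\<close>, and complements of unions are intersections.\<close>

lemma constructible_not:
  fixes S :: "(nat \<Rightarrow> 'a::idom) \<Rightarrow> bool"
  assumes "constructible V S"
  shows "constructible V (\<lambda>a. \<not> S a)"
proof -
  obtain L where L: "finite L"
    "\<forall>P q. (P, q) \<in> L \<longrightarrow> finite P \<and> P \<subseteq> polys_in V \<and> q \<in> polys_in V"
    "\<forall>a. S a \<longleftrightarrow> (\<exists>(P, q)\<in>L. locally_closed_at P q a)"
    by (rule constructibleE[OF assms])
  have "constructible V (\<lambda>a. \<not> (\<exists>(P, q)\<in>L. locally_closed_at P q a))"
    using L(1,2)
  proof (induction L rule: finite_induct)
    case (insert Pq L)
    obtain P q where Pq: "Pq = (P, q)" by force
    have "constructible V (\<lambda>a. (eval_poly a q = 0 \<or> (\<exists>p\<in>P. eval_poly a p \<noteq> 0)) \<and>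
        \<not> (\<exists>(P, q)\<in>L. locally_closed_at P q a))"
      using insert.prems Pq
      by (intro constructible_conj constructible_disj constructible_zero constructible_bex
          constructible_nonzero insert.IH) auto
    moreover have "(\<lambda>a. (eval_poly a q = 0 \<or> (\<exists>p\<in>P. eval_poly a p \<noteq> 0)) \<and>
        \<not> (\<exists>(P, q)\<in>L. locally_closed_at P q a)) = (\<lambda>a. \<not> (\<exists>(P, q)\<in>insert Pq L. locally_closed_at P q a))"
      by (auto simp: Pq fun_eq_iff locally_closed_at_def)
    ultimately show ?case by simp
  qed (simp add: constructible_True)
  thus ?thesis by (simp add: L(3)[rule_format])
qed

text \<open>Splitting on the vanishing of a leading coefficient, pseudo-division lowers the total degree of the equations
  until a single one, $P = 0$, is left; then the inequation $Q \<noteq> 0$ is compatible with it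
  unless $P$ divides $Q^{\deg P}$.\<close>

lemma constructible_exists_univariate:
  fixes Q :: "'k::{alg_closed_field, field_char_0} mpoly poly"
  assumes "finite Ps" "Ps \<subseteq> polys_over V" "Q \<in> polys_over V"
  shows "constructible V (\<lambda>a. \<exists>y. (\<forall>P\<in>Ps. poly (specialise a P) y = 0) \<and> poly (specialise a Q) y \<noteq> 0)"
    (is "constructible V (?S Ps)")
  using assms(1,2)
proof (induction "\<Sum>P\<in>Ps. psize P" arbitrary: Ps rule: less_induct)
  case less
  have smaller: "constructible V (?S (insert P' (Ps - {P})))"
    if "P \<in> Ps" "P' \<in> polys_over V" "psize P' < psize P" for P P'
  proof (rule less.hyps)
    \<comment> \<open>Only an inequality, since \<open>P'\<close> may already be among the remaining
      equations.\<close>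
    have "(\<Sum>P\<in>insert P' (Ps - {P}). psize P) \<le> psize P' + (\<Sum>P\<in>Ps - {P}. psize P)"
      using less.prems by (simp add: sum.insert_if)
    also have "\<dots> < psize P + (\<Sum>P\<in>Ps - {P}. psize P)" using that by simp
    also have "\<dots> = (\<Sum>P\<in>Ps. psize P)" using less.prems that by (simp add: sum.remove)
    finally show "(\<Sum>P\<in>insert P' (Ps - {P}). psize P) < (\<Sum>P\<in>Ps. psize P)" .
  qed (use less.prems that in auto)
  show ?case
  proof (cases "\<forall>P\<in>Ps. P = 0")
    case True
    \<comment> \<open>No genuine equation is left, so a suitable \<open>y\<close> exists exactly if
      the specialised \<open>Q\<close> is not the zero polynomial.\<close>
    have "constructible V (\<lambda>a. \<exists>i\<in>{..degree Q}. eval_poly a (coeff Q i) \<noteq> 0)"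
      by (intro constructible_bex constructible_nonzero) (use assms in auto)
    moreover have "(\<lambda>a. \<exists>i\<in>{..degree Q}. eval_poly a (coeff Q i) \<noteq> 0) = ?S Ps"
    proof
      fix a
      have "(\<exists>i\<in>{..degree Q}. eval_poly a (coeff Q i) \<noteq> 0) \<longleftrightarrow> specialise a Q \<noteq> 0"
        by (auto simp: poly_eq_iff) (metis atMost_iff coeff_eq_0 eval_0 not_le)
      also have "\<dots> \<longleftrightarrow> (\<exists>y. poly (specialise a Q) y \<noteq> 0)" using exists_nonroot by auto
      finally show "(\<exists>i\<in>{..degree Q}. eval_poly a (coeff Q i) \<noteq> 0) \<longleftrightarrow> ?S Ps a"
        using True by (metis poly_0 specialise_0)
    qed
    ultimately show ?thesis by simp
  next
    case False
    then obtain P where P: "P \<in> Ps" "P \<noteq> 0" and min: "\<And>P'. P' \<in> Ps \<Longrightarrow> P' \<noteq> 0 \<Longrightarrow> degree P \<le> degree P'"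
      using arg_min_nat_lemma[of "\<lambda>P. P \<in> Ps \<and> P \<noteq> 0" _ degree] by blast
    have PV: "P \<in> polys_over V" using P less.prems by auto
    define lc where "lc = lead_coeff P"
    have lc: "lc \<in> polys_in V" using PV by (auto simp: lc_def)
    \<comment> \<open>\<open>T\<close> is \<open>P\<close> without its leading term; both have the
      same specialisation wherever \<open>lc\<close> vanishes.\<close>
    define T where "T = P - monom lc (degree P)"
    have T: "T \<in> polys_over V" using PV lc by (auto simp: T_def)
    have "psize T < psize P"
    proof (rule psize_less[OF P(2)])
      fix i assume "degree P \<le> i"
      thus "coeff T i = 0" by (cases "i = degree P") (auto simp: T_def lc_def coeff_eq_0)
    qed
    hence "constructible V (\<lambda>a. eval_poly a lc = 0 \<and> ?S (insert T (Ps - {P})) a)"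
      by (intro constructible_conj constructible_zero lc smaller[OF P(1) T])
    moreover have "(eval_poly a lc = 0 \<and> ?S (insert T (Ps - {P})) a) = (eval_poly a lc = 0 \<and> ?S Ps a)" for a
    proof (intro conj_cong refl ex_cong1)
      fix y assume "eval_poly a lc = 0"
      hence "specialise a T = specialise a P" by (auto simp: T_def poly_eq_iff)
      thus "(\<forall>P\<in>insert T (Ps - {P}). poly (specialise a P) y = 0) \<longleftrightarrow> (\<forall>P\<in>Ps. poly (specialise a P) y = 0)"
        using P(1) by (metis (no_types, lifting) insert_Diff insert_iff)
    qed
    ultimately have zero: "constructible V (\<lambda>a. eval_poly a lc = 0 \<and> ?S Ps a)"
      by (simp only:)
    have nonzero: "constructible V (\<lambda>a. eval_poly a lc \<noteq> 0 \<and> ?S Ps a)"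
    proof (cases "\<exists>P'\<in>Ps. P' \<noteq> P \<and> P' \<noteq> 0")
      case True
      then obtain P' where P': "P' \<in> Ps" "P' \<noteq> P" "P' \<noteq> 0" by blast
      \<comment> \<open>Where \<open>lc\<close> does not vanish, \<open>P'\<close> may be replaced
        by its pseudo-remainder modulo \<open>P\<close> without changing the common zeros.\<close>
      obtain e S R where *: "R \<in> polys_over V" "smult (lc ^ e) P' = P * S + R" "psize R < psize P"
        using pseudo_division[of P' V P] less.prems(2) P P' unfolding lc_def by blast
      have "psize R < psize P'" using *(3) min[OF P'(1,3)] P' P by (auto simp: psize_def)
      hence "constructible V (\<lambda>a. eval_poly a lc \<noteq> 0 \<and> ?S (insert R (Ps - {P'})) a)"
        by (intro constructible_conj constructible_nonzero lc smaller[OF P'(1) *(1)])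
      moreover have "(eval_poly a lc \<noteq> 0 \<and> ?S (insert R (Ps - {P'})) a) = (eval_poly a lc \<noteq> 0 \<and> ?S Ps a)" for a
      proof (intro conj_cong refl ex_cong1)
        fix y assume a: "eval_poly a lc \<noteq> 0"
        have "eval_poly a lc ^ e * poly (specialise a P') y =
            poly (specialise a P) y * poly (specialise a S) y + poly (specialise a R) y"
          using arg_cong[OF *(2), of "\<lambda>U. poly (specialise a U) y"] by simp
        hence "poly (specialise a R) y = 0 \<longleftrightarrow> poly (specialise a P') y = 0" if "poly (specialise a P) y = 0"
          using that a by auto
        moreover have "P \<in> insert R (Ps - {P'})" using P P' by auto
        ultimately show "(\<forall>P\<in>insert R (Ps - {P'}). poly (specialise a P) y = 0) \<longleftrightarrow> (\<forall>P\<in>Ps. poly (specialise a P) y = 0)"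
          using P(1) P'(1) by blast
      qed
      ultimately show ?thesis by (simp only:)
    next
      case False
      hence single: "(\<forall>P\<in>Ps. poly (specialise a P) y = 0) \<longleftrightarrow> poly (specialise a P) y = 0" for a y
        using P(1) by (metis specialise_0 poly_0)
      \<comment> \<open>\<open>P\<close> is the only nonzero equation. Where \<open>lc\<close> does
        not vanish, no \<open>y\<close> exists exactly if the specialised \<open>P\<close> divides
        that power of \<open>Q\<close>, that is, if \<open>R\<close> specialises to zero.\<close>
      obtain e S R where *: "R \<in> polys_over V" "smult (lc ^ e) (Q ^ degree P) = P * S + R" "psize R < psize P"
        using pseudo_division[of "Q ^ degree P" V P] power_over[OF assms(3)] PV P unfolding lc_def by blast
      have "(eval_poly a lc \<noteq> 0 \<and> (\<exists>i\<in>{..degree R}. eval_poly a (coeff R i) \<noteq> 0)) = (eval_poly a lc \<noteq> 0 \<and> ?S Ps a)" for a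
      proof (intro conj_cong refl)
        assume a: "eval_poly a lc \<noteq> 0"
        let ?p = "specialise a P" and ?q = "specialise a Q" and ?r = "specialise a R"
        have deg: "degree ?p = degree P" using a by (simp add: lc_def degree_specialise_eq)
        have p0: "?p \<noteq> 0" using a by (metis coeff_0 coeff_specialise lc_def)
        have eq: "smult (eval_poly a lc ^ e) (?q ^ degree P) = ?p * specialise a S + ?r"
          using arg_cong[OF *(2), of "specialise a"] by simp
        have "(\<exists>i\<in>{..degree R}. eval_poly a (coeff R i) \<noteq> 0) \<longleftrightarrow> ?r \<noteq> 0"
          by (auto simp: poly_eq_iff) (metis atMost_iff coeff_eq_0 eval_0 not_le)
        also have "\<dots> \<longleftrightarrow> (\<exists>y. poly ?p y = 0 \<and> poly ?q y \<noteq> 0)"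
        proof
          assume r: "?r \<noteq> 0"
          show "\<exists>y. poly ?p y = 0 \<and> poly ?q y \<noteq> 0"
          proof (rule ccontr)
            assume "\<not> ?thesis"
            hence "?p dvd ?q ^ degree P" using dvd_power_degree[of ?p ?q] p0 deg by auto
            hence "?p dvd ?r" using eq by (metis dvd_add_right_iff dvd_smult dvd_triv_left)
            hence "degree P \<le> degree ?r" using dvd_imp_degree_le[of ?p ?r] r deg by simp
            also have "\<dots> \<le> degree R" by (rule degree_specialise_le)
            finally show False using *(3) P r by (auto simp: psize_def split: if_splits)
          qed
        next
          assume "\<exists>y. poly ?p y = 0 \<and> poly ?q y \<noteq> 0"
          then obtain y where y: "poly ?p y = 0" "poly ?q y \<noteq> 0" by blast
          show "?r \<noteq> 0"
          proof
            assume "?r = 0"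
            hence "poly (smult (eval_poly a lc ^ e) (?q ^ degree P)) y = poly ?p y * poly (specialise a S) y"
              unfolding eq by simp
            thus False using y a by simp
          qed
        qed
        finally show "(\<exists>i\<in>{..degree R}. eval_poly a (coeff R i) \<noteq> 0) \<longleftrightarrow> ?S Ps a" unfolding single .
      qed
      moreover have "constructible V (\<lambda>a. eval_poly a lc \<noteq> 0 \<and> (\<exists>i\<in>{..degree R}. eval_poly a (coeff R i) \<noteq> 0))"
        by (intro constructible_conj constructible_bex constructible_nonzero lc) (use * in auto)
      ultimately show ?thesis by (simp only:)
    qed
    have "(\<lambda>a. (eval_poly a lc = 0 \<and> ?S Ps a) \<or> (eval_poly a lc \<noteq> 0 \<and> ?S Ps a)) = ?S Ps" by auto
    thus ?thesis using constructible_disj[OF zero nonzero] by simp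
  qed
qed

section \<open>Projections and images\<close>

lemma constructible_exists:
  fixes S :: "(nat \<Rightarrow> 'k::{alg_closed_field, field_char_0}) \<Rightarrow> bool"
  assumes "constructible (insert j V) S"
  shows "constructible V (\<lambda>a. \<exists>y. S (a(j := y)))"
proof -
  obtain L where L: "finite L"
    "\<forall>P q. (P, q) \<in> L \<longrightarrow> finite P \<and> P \<subseteq> polys_in (insert j V) \<and> q \<in> polys_in (insert j V)"
    "\<forall>a. S a \<longleftrightarrow> (\<exists>(P, q)\<in>L. locally_closed_at P q a)"
    by (rule constructibleE[OF assms])
  let ?T = "\<lambda>(P, q) a. \<exists>y. (\<forall>p\<in>uni j ` P. poly (specialise a p) y = 0) \<and> poly (specialise a (uni j q)) y \<noteq> 0"
  have "constructible V (\<lambda>a. \<exists>Pq\<in>L. ?T Pq a)"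
  proof (rule constructible_bex[OF L(1)])
    fix Pq assume "Pq \<in> L"
    then obtain P q where Pq: "Pq = (P, q)" "(P, q) \<in> L" by (cases Pq) auto
    show "constructible V (?T Pq)"
      unfolding Pq(1) prod.case
      by (rule constructible_exists_univariate) (use L(2)[rule_format, OF Pq(2)] in \<open>auto intro: uni_over\<close>)
  qed
  moreover have "(\<lambda>a. \<exists>Pq\<in>L. ?T Pq a) = (\<lambda>a. \<exists>y. S (a(j := y)))"
    unfolding L(3)[rule_format] by (fastforce simp: fun_eq_iff locally_closed_at_def poly_specialise_uni)
  ultimately show ?thesis by simp
qed

text \<open>The coordinates in \<open>J\<close> are quantified at once by letting \<open>b\<close>
  agree with \<open>a\<close> outside \<open>J\<close>; the induction eliminates them one at a
  time.\<close>

lemma constructible_exists_finite: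
  fixes S :: "(nat \<Rightarrow> 'k::{alg_closed_field, field_char_0}) \<Rightarrow> bool"
  assumes "finite J" "constructible (J \<union> V) S"
  shows "constructible V (\<lambda>a. \<exists>b. (\<forall>i. i \<notin> J \<longrightarrow> b i = a i) \<and> S b)"
  using assms
proof (induction J arbitrary: S rule: finite_induct)
  case empty
  hence "(\<lambda>a. \<exists>b. (\<forall>i. i \<notin> {} \<longrightarrow> b i = a i) \<and> S b) = S" by (auto simp: fun_eq_iff) (metis ext)
  thus ?case using empty by simp
next
  case (insert j J)
  have "constructible V (\<lambda>a. \<exists>b. (\<forall>i. i \<notin> J \<longrightarrow> b i = a i) \<and> (\<exists>y. S (b(j := y))))"
    using insert by (intro insert.IH constructible_exists) auto
  moreover have "(\<lambda>a. \<exists>b. (\<forall>i. i \<notin> J \<longrightarrow> b i = a i) \<and> (\<exists>y. S (b(j := y)))) =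
      (\<lambda>a. \<exists>b. (\<forall>i. i \<notin> insert j J \<longrightarrow> b i = a i) \<and> S b)"
  proof (intro ext iffI; elim exE conjE)
    fix a b y assume "\<forall>i. i \<notin> J \<longrightarrow> b i = a i" "S (b(j := y))"
    thus "\<exists>b. (\<forall>i. i \<notin> insert j J \<longrightarrow> b i = a i) \<and> S b" by (intro exI[of _ "b(j := y)"]) auto
  next
    fix a b assume "\<forall>i. i \<notin> insert j J \<longrightarrow> b i = a i" "S b"
    thus "\<exists>b. (\<forall>i. i \<notin> J \<longrightarrow> b i = a i) \<and> (\<exists>y. S (b(j := y)))"
      using insert.hyps by (intro exI[of _ "b(j := a j)"] conjI exI[of _ "b j"]) auto
  qed
  ultimately show ?case by simp
qed

text \<open>The graph of the map is closed, and the image is its projection. The source coordinates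
  are shifted to the indices \<open>M + 1..M + N\<close> to keep them apart from the target
  coordinates.\<close>

lemma constructible_image:
  fixes h :: "nat \<Rightarrow> 'k::{alg_closed_field, field_char_0} mpoly"
  assumes "\<And>i. i \<in> {1..M} \<Longrightarrow> h i \<in> polys_in {1..N}"
  shows "constructible {1..M} (\<lambda>x. \<exists>a. \<forall>i\<in>{1..M}. x i = eval_poly a (h i))"
proof -
  let ?J = "{M + 1..M + N}"
  let ?E = "(\<lambda>i. Var i - compose_poly (\<lambda>l. Var (l + M)) (h i)) ` {1..M}"
  have "constructible (?J \<union> {1..M}) (locally_closed_at ?E 1)"
  proof (rule constructible_locally_closed)
    show "?E \<subseteq> polys_in (?J \<union> {1..M})"
      by (auto intro!: diff_in_polys compose_in_polys[OF assms])
  qed auto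
  hence "constructible {1..M} (\<lambda>x. \<exists>b. (\<forall>i. i \<notin> ?J \<longrightarrow> b i = x i) \<and> locally_closed_at ?E 1 b)"
    by (intro constructible_exists_finite) auto
  moreover have "(\<lambda>x. \<exists>b. (\<forall>i. i \<notin> ?J \<longrightarrow> b i = x i) \<and> locally_closed_at ?E 1 b) =
      (\<lambda>x. \<exists>a. \<forall>i\<in>{1..M}. x i = eval_poly a (h i))"
  proof (intro ext iffI; elim exE conjE)
    fix x b assume "\<forall>i. i \<notin> ?J \<longrightarrow> b i = x i" "locally_closed_at ?E 1 b"
    thus "\<exists>a. \<forall>i\<in>{1..M}. x i = eval_poly a (h i)"
      by (intro exI[of _ "\<lambda>l. b (l + M)"]) (auto simp: locally_closed_at_def eval_compose)
  next
    fix x a assume a: "\<forall>i\<in>{1..M}. x i = eval_poly a (h i)"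
    let ?b = "\<lambda>l. if l \<in> ?J then a (l - M) else x l"
    have "eval_poly (\<lambda>l. ?b (l + M)) (h i) = eval_poly a (h i)" if "i \<in> {1..M}" for i
      by (rule eval_cong[OF assms[OF that]]) auto
    thus "\<exists>b. (\<forall>i. i \<notin> ?J \<longrightarrow> b i = x i) \<and> locally_closed_at ?E 1 b"
      using a by (intro exI[of _ ?b]) (auto simp: locally_closed_at_def eval_compose)
  qed
  ultimately show ?thesis by simp
qed

section \<open>Divisibility in several variables\<close>

text \<open>Interpolation, with \<open>I\<close> a subspace over the field of constants. After
  subtracting the value at \<open>x0\<close>, the linear factor at \<open>x0\<close> can be divided
  out; at every other admissible constant \<open>x\<close> the quotient takes a scalar multiple of a
  difference of values, and its degree is smaller.\<close>

lemma coeffs_mem_of_values_mem: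
  fixes T :: "'a::field_char_0 mpoly poly"
  assumes "finite B" "\<And>x. x \<notin> B \<Longrightarrow> poly T (const_poly x) \<in> I"
    and add: "\<And>u v. u \<in> I \<Longrightarrow> v \<in> I \<Longrightarrow> u + v \<in> I"
    and scale: "\<And>u c. u \<in> I \<Longrightarrow> const_poly c * u \<in> I"
  shows "coeff T i \<in> I"
  using assms(1,2)
proof (induction "degree T" arbitrary: T B i rule: less_induct)
  case less
  obtain x0 where x0: "x0 \<notin> B" using less.prems(1) ex_new_if_finite infinite_UNIV_char_0 by blast
  define t0 where "t0 = poly T (const_poly x0)"
  have t0: "t0 \<in> I" unfolding t0_def using less.prems x0 by blast
  hence zero: "0 \<in> I" using scale[of t0 0] by simp
  have diff: "u - v \<in> I" if "u \<in> I" "v \<in> I" for u v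
  proof -
    have "u - v = u + const_poly (0 - 1) * v" unfolding const_poly_diff by simp
    also have "\<dots> \<in> I" using that by (intro add scale)
    finally show ?thesis .
  qed
  have "poly (T - [:t0:]) (const_poly x0) = 0" by (simp add: t0_def)
  then obtain T1 where "T - [:t0:] = [:- const_poly x0, 1:] * T1" unfolding poly_eq_0_iff_dvd by blast
  hence T: "T = [:t0:] + [:- const_poly x0, 1:] * T1" by (simp add: algebra_simps)
  show ?case
  proof (cases "T1 = 0")
    case True
    thus ?thesis using t0 zero unfolding T by (auto simp: coeff_pCons split: nat.splits)
  next
    case False
    have "degree ([:- const_poly x0, 1:] * T1) = Suc (degree T1)"
      using False by (subst degree_mult_eq) auto
    hence "degree T = Suc (degree T1)" unfolding T by (subst degree_add_eq_right) auto
    moreover have "poly T1 (const_poly x) \<in> I" if x: "x \<notin> insert x0 B" for x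
    proof -
      have "poly T (const_poly x) - t0 = const_poly (x - x0) * poly T1 (const_poly x)"
        unfolding T by (simp add: const_poly_diff algebra_simps)
      hence "const_poly (1 / (x - x0)) * (poly T (const_poly x) - t0) =
          const_poly (1 / (x - x0) * (x - x0)) * poly T1 (const_poly x)"
        unfolding const_poly_mult by (simp add: mult.assoc)
      also have "\<dots> = poly T1 (const_poly x)" using x by simp
      finally show ?thesis using x less.prems(2) t0 by (metis scale diff insert_iff)
    qed
    ultimately have T1: "coeff T1 i \<in> I" for i
      using less.hyps[of T1 "insert x0 B"] less.prems(1) by simp
    have *: "coeff T i = coeff [:t0:] i + (coeff (pCons 0 T1) i - const_poly x0 * coeff T1 i)"
      unfolding T by simp
    show ?thesis unfolding *
      by (intro add diff scale T1) (auto simp: coeff_pCons T1 t0 zero split: nat.splits)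
  qed
qed

lemma smult_of_coeffs:
  assumes "\<And>i. \<exists>u\<in>polys_in V. coeff T i = d * u"
  shows "\<exists>U\<in>polys_over V. T = smult d U"
  using assms
proof (induction T)
  case 0
  show ?case by (intro bexI[of _ 0]) auto
next
  case (pCons c T)
  have "\<exists>u\<in>polys_in V. coeff T i = d * u" for i using pCons.prems[of "Suc i"] by simp
  then obtain U where "U \<in> polys_over V" "T = smult d U" using pCons.IH by blast
  moreover obtain u where "u \<in> polys_in V" "c = d * u" using pCons.prems[of 0] by auto
  ultimately show ?case by (intro bexI[of _ "pCons u U"]) (auto simp: pCons_over)
qed

text \<open>Induction on the number of variables: for almost every constant \<open>x\<close> the hypothesis survives setting $x_j = x$,
  so there $P$ divides $Q$ and $d_j$ divides the cofactor $S$ of $d_j Q = P S$; interpolation at these constants shows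
  that $d_j$ divides every coefficient of $S$.\<close>

lemma dvd_if_dvd_free_multiples:
  fixes P Q :: "'a::field_char_0 mpoly"
  assumes "finite V" "P \<in> polys_in V" "Q \<in> polys_in V" "P \<noteq> 0"
    and "\<And>j. j \<in> V \<Longrightarrow> \<exists>d\<in>polys_in (V - {j}). d \<noteq> 0 \<and> (\<exists>S\<in>polys_in V. d * Q = P * S)"
  shows "\<exists>S\<in>polys_in V. Q = P * S"
  using assms
proof (induction V arbitrary: P Q rule: finite_induct)
  case empty
  define c d where "c = eval_poly (\<lambda>_. 0) P" and "d = eval_poly (\<lambda>_. 0) Q"
  have "P = const_poly c" "Q = const_poly d"
    unfolding c_def d_def using empty const_poly_eval_empty by blast+
  moreover from this have "c \<noteq> 0" using empty by auto
  ultimately have "Q = P * const_poly (d / c)" by (simp flip: const_poly_mult)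
  thus ?case by auto
next
  case (insert j V)
  have "\<exists>d S. d \<in> polys_in (insert j V - {i}) \<and> d \<noteq> 0 \<and> S \<in> polys_in (insert j V) \<and> d * Q = P * S" if "i \<in> insert j V" for i
    using insert.prems(4)[OF that] by blast
  then obtain d S where d: "\<And>i. i \<in> insert j V \<Longrightarrow> d i \<in> polys_in (insert j V - {i})"
      "\<And>i. i \<in> insert j V \<Longrightarrow> d i \<noteq> 0" and S: "\<And>i. i \<in> insert j V \<Longrightarrow> S i \<in> polys_in (insert j V)"
      "\<And>i. i \<in> insert j V \<Longrightarrow> d i * Q = P * S i"
    by metis
  have dj: "d j \<in> polys_in V" using d(1)[of j] insert.hyps by simp
  \<comment> \<open>\<open>\<theta> x\<close> sets the variable \<open>j\<close> to the constant
    \<open>x\<close>, which lands in the ring over \<open>V\<close> where the induction hypothesis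
    applies.\<close>
  define \<theta> where "\<theta> x p = poly (uni j p) (const_poly x)" for x :: 'a and p :: "'a mpoly"
  have \<theta>_mult: "\<theta> x (p * q) = \<theta> x p * \<theta> x q" for x p q by (simp add: \<theta>_def)
  have \<theta>_in: "\<theta> x p \<in> polys_in W" if "p \<in> polys_in (insert j W)" for x p W
    unfolding \<theta>_def poly_altdef using uni_over[OF that]
    by (intro sum_in_polys mult_in_polys power_in_polys) auto
  have \<theta>_free: "\<theta> x p = p" if "p \<in> polys_in V" for x p
    using uni_free[OF that insert.hyps(2)] by (simp add: \<theta>_def)
  have fin: "finite {x. \<theta> x p = 0}" if "p \<noteq> 0" for p
  proof -
    have "finite {x. poly (uni j p) x = 0}" using that by (intro poly_roots_finite) simp
    \<comment> \<open>The roots live in the polynomial ring; constants embed into it injectively, so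
      only finitely many of them are roots.\<close>
    hence "finite (const_poly -` {x. poly (uni j p) x = 0})"
      by (rule finite_vimageI) (metis const_poly_diff const_poly_eq_0_iff injI right_minus_eq)
    thus ?thesis by (simp add: \<theta>_def vimage_def)
  qed
  \<comment> \<open>The excluded constants are those at which \<open>P\<close> or some
    \<open>d i\<close> becomes zero, which would destroy a hypothesis of the induction.\<close>
  define B where "B = {x. \<theta> x P = 0} \<union> (\<Union>i\<in>V. {x. \<theta> x (d i) = 0})"
  have "finite B" unfolding B_def using insert.hyps(1) insert.prems(3) d(2) by (auto intro!: fin)
  moreover have "poly (uni j (S j)) (const_poly x) \<in> {d j * u |u. u \<in> polys_in V}" if x: "x \<notin> B" for x
  proof -
    have "\<exists>U\<in>polys_in V. \<theta> x Q = \<theta> x P * U"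
    proof (rule insert.IH)
      fix i assume i: "i \<in> V"
      hence "i \<noteq> j" using insert.hyps by auto
      hence "\<theta> x (d i) \<in> polys_in (V - {i})"
        using d(1)[of i] i by (intro \<theta>_in) (simp add: insert_Diff_if)
      moreover have "\<theta> x (d i) \<noteq> 0" using x i by (auto simp: B_def)
      moreover have "\<theta> x (d i) * \<theta> x Q = \<theta> x P * \<theta> x (S i)" using S(2)[of i] i by (simp flip: \<theta>_mult)
      ultimately show "\<exists>d\<in>polys_in (V - {i}). d \<noteq> 0 \<and> (\<exists>S\<in>polys_in V. d * \<theta> x Q = \<theta> x P * S)"
        using \<theta>_in[OF S(1)[of i]] i by blast
    qed (use x insert.prems in \<open>auto simp: B_def intro: \<theta>_in\<close>)
    then obtain u where u: "u \<in> polys_in V" "\<theta> x Q = \<theta> x P * u" by blast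
    \<comment> \<open>\<open>d j\<close> does not involve the variable \<open>j\<close> and is fixed
      by \<open>\<theta> x\<close>; cancelling \<open>\<theta> x P\<close> then exhibits it as a
      factor of \<open>\<theta> x (S j)\<close>.\<close>
    have "d j * \<theta> x Q = \<theta> x P * \<theta> x (S j)"
      using arg_cong[OF S(2)[of j], of "\<theta> x"] \<theta>_free[OF dj] by (simp add: \<theta>_mult)
    hence "\<theta> x P * (d j * u) = \<theta> x P * \<theta> x (S j)" using u by (simp add: algebra_simps)
    hence "\<theta> x (S j) = d j * u" using x by (simp add: B_def)
    thus ?thesis using u unfolding \<theta>_def by blast
  qed
  ultimately have "coeff (uni j (S j)) i \<in> {d j * u |u. u \<in> polys_in V}" for i
  proof (rule coeffs_mem_of_values_mem)
    fix u v c assume "u \<in> {d j * u |u. u \<in> polys_in V}"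
    then obtain u' where u': "u' \<in> polys_in V" "u = d j * u'" by blast
    have "const_poly c * u = d j * (const_poly c * u')" by (simp add: u'(2) mult_ac)
    moreover have "const_poly c * u' \<in> polys_in V" using u' by auto
    ultimately show "const_poly c * u \<in> {d j * u |u. u \<in> polys_in V}" by blast
    assume "v \<in> {d j * u |u. u \<in> polys_in V}"
    then obtain v' where v': "v' \<in> polys_in V" "v = d j * v'" by blast
    have "u + v = d j * (u' + v')" by (simp add: u'(2) v'(2) distrib_left)
    moreover have "u' + v' \<in> polys_in V" using u' v' by auto
    ultimately show "u + v \<in> {d j * u |u. u \<in> polys_in V}" by blast
  qed
  then obtain U where U: "U \<in> polys_over V" "uni j (S j) = smult (d j) U"
    using smult_of_coeffs[of V "uni j (S j)" "d j"] by blast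
  have "S j = d j * poly U (Var j)" using arg_cong[OF U(2), of "\<lambda>U. poly U (Var j)"] by simp
  hence "d j * Q = d j * (P * poly U (Var j))" using S(2)[of j] by (simp add: mult_ac)
  hence "Q = P * poly U (Var j)" using d(2)[of j] by simp
  thus ?case using poly_in_polys[OF U(1)] by blast
qed

text \<open>The Nullstellensatz for the ideal generated by \<open>P\<close>. In each variable
  \<open>j\<close> the univariate root argument gives divisibility up to a factor free of
  \<open>j\<close>; \<open>dvd_if_dvd_free_multiples\<close> removes these factors.\<close>

lemma dvd_power_if_zeros_subset:
  fixes P Q :: "'k::{alg_closed_field, field_char_0} mpoly"
  assumes V: "finite V" and P: "P \<in> polys_in V" "P \<noteq> 0" and Q: "Q \<in> polys_in V"
    and zeros: "\<And>a. eval_poly a P = 0 \<Longrightarrow> eval_poly a Q = 0"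
  shows "\<exists>r. \<exists>S\<in>polys_in V. Q ^ r = P * S"
proof -
  have "\<exists>D. \<exists>d\<in>polys_in (V - {j}). d \<noteq> 0 \<and> (\<exists>S\<in>polys_in V. d * Q ^ D = P * S)" if j: "j \<in> V" for j
  proof -
    define W where "W = V - {j}"
    have VW: "insert j W = V" "j \<notin> W" using j by (auto simp: W_def)
    define p q where "p = uni j P" and "q = uni j Q"
    have pq: "p \<in> polys_over W" "q \<in> polys_over W" "p \<noteq> 0"
      using P Q by (auto simp: p_def q_def VW intro: uni_over)
    obtain e S R where *: "S \<in> polys_over W" "R \<in> polys_over W"
      "smult (lead_coeff p ^ e) (q ^ degree p) = p * S + R" "psize R < psize p"
      using pseudo_division[of "q ^ degree p" W p] power_over[OF pq(2)] pq by blast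
    have "R = 0"
    proof (rule poly_eqI)
      fix i
      \<comment> \<open>The root argument applies only where the leading coefficient is nonzero; the
        additional factor makes the statement hold at every point.\<close>
      have "eval_poly a (lead_coeff p * coeff R i) = 0" for a
      proof (cases "eval_poly a (lead_coeff p) = 0")
        case False
        let ?p = "specialise a p" and ?q = "specialise a q" and ?r = "specialise a R"
        have p0: "?p \<noteq> 0" using False by (metis coeff_0 coeff_specialise)
        have deg: "degree ?p = degree p" using False by (simp add: degree_specialise_eq)
        have "?p dvd ?q ^ degree p"
          using dvd_power_degree[OF p0, of ?q] deg zeros by (simp add: p_def q_def poly_specialise_uni)
        moreover have "smult (eval_poly a (lead_coeff p) ^ e) (?q ^ degree p) = ?p * specialise a S + ?r"
          using arg_cong[OF *(3), of "specialise a"] by simp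
        ultimately have "?p dvd ?r" by (metis dvd_add_right_iff dvd_smult dvd_triv_left)
        have "?r = 0"
        proof (rule ccontr)
          assume r: "?r \<noteq> 0"
          hence "degree p \<le> degree ?r" using dvd_imp_degree_le[OF \<open>?p dvd ?r\<close>] deg by simp
          also have "\<dots> \<le> degree R" by (rule degree_specialise_le)
          finally show False using *(4) r pq(3) by (auto simp: psize_def split: if_splits)
        qed
        thus ?thesis by (metis coeff_0 coeff_specialise eval_mult mult_zero_right)
      qed simp
      hence "lead_coeff p * coeff R i = 0" by (rule eval_all_0_imp_0)
      thus "coeff R i = coeff 0 i" using pq by simp
    qed
    hence "smult (lead_coeff p ^ e) (q ^ degree p) = p * S" using * by simp
    from arg_cong[OF this, of "\<lambda>U. poly U (Var j)"]
    have "lead_coeff p ^ e * Q ^ degree p = P * poly S (Var j)" by (simp add: p_def q_def)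
    moreover have "lead_coeff p ^ e \<in> polys_in W" "lead_coeff p ^ e \<noteq> 0" using pq by auto
    moreover have "poly S (Var j) \<in> polys_in V" using poly_in_polys[OF *(1), of j] VW by simp
    ultimately show ?thesis unfolding W_def by blast
  qed
  then obtain D where D: "\<And>j. j \<in> V \<Longrightarrow> \<exists>d\<in>polys_in (V - {j}). d \<noteq> 0 \<and> (\<exists>S\<in>polys_in V. d * Q ^ D j = P * S)"
    by metis
  \<comment> \<open>One exponent at least as large as every \<open>D j\<close>.\<close>
  define r where "r = sum D V"
  have "\<exists>S\<in>polys_in V. Q ^ r = P * S"
  proof (rule dvd_if_dvd_free_multiples[OF V P(1) _ P(2)])
    fix j assume j: "j \<in> V"
    then obtain d S where d: "d \<in> polys_in (V - {j})" "d \<noteq> 0" "S \<in> polys_in V" "d * Q ^ D j = P * S"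
      using D by blast
    have "D j \<le> r" unfolding r_def using j V by (intro member_le_sum) auto
    hence "Q ^ r = Q ^ D j * Q ^ (r - D j)" by (simp flip: power_add)
    hence "d * Q ^ r = P * (S * Q ^ (r - D j))" using d(4) by (metis mult.assoc)
    moreover have "S * Q ^ (r - D j) \<in> polys_in V" using d Q by auto
    ultimately show "\<exists>d\<in>polys_in (V - {j}). d \<noteq> 0 \<and> (\<exists>S\<in>polys_in V. d * Q ^ r = P * S)"
      using d by blast
  qed (use Q in auto)
  thus ?thesis by blast
qed

section \<open>Hypersurfaces outside the image\<close>

text \<open>Points are total functions here; only the coordinates in \<open>{1..m}\<close> matter.\<close>

definition in_image :: "nat \<Rightarrow> (nat \<Rightarrow> 'a::comm_semiring_1 mpoly) \<Rightarrow> (nat \<Rightarrow> 'a) \<Rightarrow> bool" where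
  "in_image m f x \<longleftrightarrow> (\<exists>a. \<forall>i\<in>{1..m}. x i = eval_poly a (f i))"

section \<open>Almost surjectivity as a condition on each variable\<close>

lemma eval_restrict: "p \<in> polys_in V \<Longrightarrow> eval_poly (restrict a V) p = eval_poly a p"
  by (rule eval_cong) auto

lemma restrict_affine [simp]: "restrict a {1..n} \<in> affine_space n"
  by (simp add: affine_space_def)

text \<open>The zero set of any \<open>p\<close> that vanishes on \<open>C\<close> is algebraic,
  hence contains the closure. The dimension can therefore be read off from \<open>C\<close>
  itself.\<close>

lemma vanishing_ideal_closure:
  fixes C :: "(nat \<Rightarrow> 'a::comm_semiring_1) set"
  assumes "C \<subseteq> affine_space m"
  shows "vanishing_ideal m (zariski_closure m C) = vanishing_ideal m C"
proof
  show "vanishing_ideal m (zariski_closure m C) \<subseteq> vanishing_ideal m C"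
    using hull_subset[of C "algebraic_set m"] by (auto simp: vanishing_ideal_def zariski_closure_def)
  show "vanishing_ideal m C \<subseteq> vanishing_ideal m (zariski_closure m C)"
  proof
    fix p assume p: "p \<in> vanishing_ideal m C"
    have "algebraic_set m {a \<in> affine_space m. eval_poly a p = 0}"
      unfolding algebraic_set_def by (intro exI[of _ "{p}"]) (use p in \<open>auto simp: vanishing_ideal_def\<close>)
    hence "zariski_closure m C \<subseteq> {a \<in> affine_space m. eval_poly a p = 0}"
      unfolding zariski_closure_def by (intro hull_minimal) (use p assms in \<open>auto simp: vanishing_ideal_def\<close>)
    thus "p \<in> vanishing_ideal m (zariski_closure m C)" using p by (auto simp: vanishing_ideal_def)
  qed
qed

text \<open>The constant 1 has no zeros, so the empty set is algebraic. This matches the case of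
  dimension -1 with an empty \<open>C\<close>.\<close>

lemma zariski_closure_empty_iff: "zariski_closure m C = {} \<longleftrightarrow> C = {}"
proof
  assume "C = {}"
  moreover have "algebraic_set m ({} :: (nat \<Rightarrow> 'a) set)"
    unfolding algebraic_set_def by (intro exI[of _ "{1}"]) auto
  ultimately show "zariski_closure m C = {}"
    unfolding zariski_closure_def by (metis hull_same)
qed (use hull_subset[of C "algebraic_set m"] in \<open>auto simp: zariski_closure_def\<close>)

text \<open>Dimension at most \<open>m - 2\<close> says that any \<open>m - 1\<close> of the
  variables satisfy a nonzero relation on the complement of the image. Stated for each omitted
  variable \<open>j\<close>, this fits the hypothesis of
  \<open>dvd_if_dvd_free_multiples\<close>.\<close>

lemma almost_surjective_iff:
  fixes f :: "nat \<Rightarrow> 'a::idom mpoly"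
  assumes m: "m \<ge> 1" and f: "\<And>i. i \<in> {1..m} \<Longrightarrow> f i \<in> polys_in {1..n}"
  shows "almost_surjective n m f \<longleftrightarrow>
    (\<forall>j\<in>{1..m}. \<exists>d\<in>polys_in ({1..m} - {j}). d \<noteq> 0 \<and> (\<forall>x. \<not> in_image m f x \<longrightarrow> eval_poly x d = 0))"
proof -
  define C where "C = affine_space m - range_map n m f"
  have C_iff: "restrict x {1..m} \<in> C \<longleftrightarrow> \<not> in_image m f x" for x
  proof -
    have "restrict x {1..m} \<in> range_map n m f \<longleftrightarrow> in_image m f x"
    proof
      assume "restrict x {1..m} \<in> range_map n m f"
      then obtain a where "restrict x {1..m} = (\<lambda>i\<in>{1..m}. eval_poly a (f i))"
        by (auto simp: range_map_def)
      hence "\<forall>i\<in>{1..m}. x i = eval_poly a (f i)" by (metis restrict_apply')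
      thus "in_image m f x" by (auto simp: in_image_def)
    next
      assume "in_image m f x"
      then obtain a where a: "\<forall>i\<in>{1..m}. x i = eval_poly a (f i)" by (auto simp: in_image_def)
      hence "restrict x {1..m} = (\<lambda>i\<in>{1..m}. eval_poly (restrict a {1..n}) (f i))"
        using f by (intro restrict_ext) (simp add: eval_restrict)
      thus "restrict x {1..m} \<in> range_map n m f" unfolding range_map_def using restrict_affine by blast
    qed
    thus ?thesis unfolding C_def using restrict_affine by blast
  qed
  have C_restrict: "restrict x {1..m} = x" if "x \<in> C" for x
    using that unfolding C_def affine_space_def by (intro extensional_restrict) (auto simp: PiE_def)
  have van: "d \<in> vanishing_ideal m C \<longleftrightarrow> (\<forall>x. \<not> in_image m f x \<longrightarrow> eval_poly x d = 0)"
    if d: "d \<in> polys_in {1..m}" for d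
  proof -
    have "(\<forall>x\<in>C. eval_poly x d = 0) \<longleftrightarrow> (\<forall>x. \<not> in_image m f x \<longrightarrow> eval_poly x d = 0)"
      using C_iff C_restrict eval_restrict[OF d] by metis
    thus ?thesis using d by (simp add: vanishing_ideal_def)
  qed
  let ?I = "vanishing_ideal m C"
  let ?D = "{card D |D. D \<subseteq> {1..m} \<and> ?I \<inter> polys_in D = {0}}"
  have zero: "0 \<in> ?I" by (simp add: vanishing_ideal_def)
  have I: "vanishing_ideal m (zariski_closure m C) = ?I"
    by (rule vanishing_ideal_closure) (auto simp: C_def)
  have dim: "almost_surjective n m f \<longleftrightarrow> (C = {} \<or> (\<forall>D\<subseteq>{1..m}. ?I \<inter> polys_in D = {0} \<longrightarrow> int (card D) \<le> int m - 2))"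
  proof (cases "C = {}")
    case True
    thus ?thesis using m zariski_closure_empty_iff[of m C]
      by (simp add: almost_surjective_def algebraic_dim_def flip: C_def)
  next
    case False
    have fin: "finite ?D" by (rule finite_subset[of _ "card ` Pow {1..m}"]) auto
    \<comment> \<open>Makes the set under \<open>Max\<close> nonempty: a constant that vanishes at a
      point of \<open>C\<close> is zero.\<close>
    have "?I \<inter> polys_in {} = {0}"
    proof -
      obtain x where x: "x \<in> C" using False by blast
      have "p = 0" if "p \<in> ?I" "p \<in> polys_in {}" for p
        using that x const_poly_eval_empty[of p x] by (simp add: vanishing_ideal_def)
      thus ?thesis using zero by auto
    qed
    hence "\<exists>c. c \<in> ?D" by (intro exI[of _ "card {}"] CollectI exI[of _ "{}"]) simp
    hence ne: "?D \<noteq> {}" by blast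
    have "almost_surjective n m f \<longleftrightarrow> int (Max ?D) \<le> int m - 2"
      using False zariski_closure_empty_iff[of m C]
      by (simp add: almost_surjective_def algebraic_dim_def I flip: C_def)
    also have "\<dots> \<longleftrightarrow> (\<forall>c\<in>?D. int c \<le> int m - 2)"
    proof
      assume le: "int (Max ?D) \<le> int m - 2"
      show "\<forall>c\<in>?D. int c \<le> int m - 2"
      proof
        fix c assume "c \<in> ?D"
        hence "c \<le> Max ?D" by (rule Max_ge[OF fin])
        thus "int c \<le> int m - 2" using le by linarith
      qed
    next
      assume "\<forall>c\<in>?D. int c \<le> int m - 2"
      thus "int (Max ?D) \<le> int m - 2" by (rule bspec) (rule Max_in[OF fin ne])
    qed
    also have "\<dots> \<longleftrightarrow> (\<forall>D\<subseteq>{1..m}. ?I \<inter> polys_in D = {0} \<longrightarrow> int (card D) \<le> int m - 2)" by auto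
    finally show ?thesis using False by simp
  qed
  show ?thesis
  proof
    assume as: "almost_surjective n m f"
    show "\<forall>j\<in>{1..m}. \<exists>d\<in>polys_in ({1..m} - {j}). d \<noteq> 0 \<and> (\<forall>x. \<not> in_image m f x \<longrightarrow> eval_poly x d = 0)"
    proof
      fix j assume j: "j \<in> {1..m}"
      show "\<exists>d\<in>polys_in ({1..m} - {j}). d \<noteq> 0 \<and> (\<forall>x. \<not> in_image m f x \<longrightarrow> eval_poly x d = 0)"
      proof (cases "C = {}")
        case True
        hence "in_image m f x" for x using C_iff[of x] by simp
        thus ?thesis by (intro bexI[of _ 1]) auto
      next
        case False
        have "\<not> int (card ({1..m} - {j})) \<le> int m - 2" using j m by simp
        hence "?I \<inter> polys_in ({1..m} - {j}) \<noteq> {0}"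
          using as False m unfolding dim by (meson Diff_subset)
        then obtain d where d: "d \<in> ?I" "d \<in> polys_in ({1..m} - {j})" "d \<noteq> 0" using zero by auto
        have "d \<in> polys_in {1..m}" using d(2) by (rule polys_in_mono[rotated]) auto
        thus ?thesis using van[of d] d by blast
      qed
    qed
  next
    assume *: "\<forall>j\<in>{1..m}. \<exists>d\<in>polys_in ({1..m} - {j}). d \<noteq> 0 \<and> (\<forall>x. \<not> in_image m f x \<longrightarrow> eval_poly x d = 0)"
    show "almost_surjective n m f"
      unfolding dim
    proof (intro disjI2 allI impI)
      fix D assume D: "D \<subseteq> {1..m}" "?I \<inter> polys_in D = {0}"
      show "int (card D) \<le> int m - 2"
      proof (rule ccontr)
        assume "\<not> ?thesis"
        \<comment> \<open>At most one index is missing from \<open>D\<close>; it serves as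
          \<open>j\<close>, and if none is missing, \<open>j = 1\<close> will do.\<close>
        hence "card ({1..m} - D) \<le> 1" using D(1) by (simp add: card_Diff_subset finite_subset)
        moreover have fin: "finite ({1..m} - D)" by simp
        ultimately obtain j where j: "j \<in> {1..m}" "{1..m} - {j} \<subseteq> D"
        proof (cases "{1..m} - D = {}")
          case True
          thus ?thesis using m by (intro that[of 1]) auto
        next
          case False
          then obtain j where "j \<in> {1..m} - D" by blast
          moreover have "card ({1..m} - D) \<le> Suc 0" using \<open>card ({1..m} - D) \<le> 1\<close> by simp
          ultimately show ?thesis using card_le_Suc0_iff_eq[OF fin] by (intro that[of j]) auto
        qed
        obtain d where d: "d \<in> polys_in ({1..m} - {j})" "d \<noteq> 0" "\<forall>x. \<not> in_image m f x \<longrightarrow> eval_poly x d = 0"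
          using * j(1) by blast
        have "d \<in> polys_in D" using d(1) j(2) polys_in_mono by blast
        moreover from this have "d \<in> ?I" using van[of d] d D(1) polys_in_mono by blast
        ultimately show False using D(2) d(2) by blast
      qed
    qed
  qed
qed

section \<open>From equality of the algebras to almost surjectivity\<close>

lemma compose_eq_0_iff:
  "algebraically_independent m f \<Longrightarrow> p \<in> polys_in {1..m} \<Longrightarrow> compose_poly f p = 0 \<longleftrightarrow> p = 0"
  by (auto simp: algebraically_independent_def)

lemma eval_compose_in_image:
  assumes "\<forall>i\<in>{1..m}. x i = eval_poly a (f i)" "p \<in> polys_in {1..m}"
  shows "eval_poly a (compose_poly f p) = eval_poly x p"
  unfolding eval_compose by (rule eval_cong[OF assms(2)]) (use assms(1) in auto)

text \<open>Hypothesis \<open>no\<close> is the failure of the condition on \<open>j\<close>. By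
  Chevalley the complement of the image is a finite union of locally closed pieces, and one of them
  satisfies no relation free of \<open>j\<close>. The relations on it are generated, up to leading
  coefficients, by one \<open>G\<close>, which supplies \<open>p\<close>.\<close>

lemma hypersurface_outside_image:
  fixes f :: "nat \<Rightarrow> 'k::{alg_closed_field, field_char_0} mpoly"
  assumes f: "\<And>i. i \<in> {1..m} \<Longrightarrow> f i \<in> polys_in {1..n}" and indep: "algebraically_independent m f"
    and j: "j \<in> {1..m}"
    and no: "\<And>d. d \<in> polys_in ({1..m} - {j}) \<Longrightarrow> d \<noteq> 0 \<Longrightarrow> \<exists>x. \<not> in_image m f x \<and> eval_poly x d \<noteq> 0"
  obtains p q x where "p \<in> polys_in {1..m}" "q \<in> polys_in {1..m}" "p \<noteq> 0"
    "\<forall>x. in_image m f x \<longrightarrow> eval_poly x p = 0 \<longrightarrow> eval_poly x q = 0"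
    "eval_poly x p = 0" "eval_poly x q \<noteq> 0"
proof -
  define W where "W = {1..m} - {j}"
  have W: "insert j W = {1..m}" "j \<notin> W" using j by (auto simp: W_def)
  have "constructible {1..m} (\<lambda>x. \<not> in_image m f x)"
    unfolding in_image_def by (intro constructible_not constructible_image[of m f n] f)
  then obtain L where L: "finite L" "\<forall>P q. (P, q) \<in> L \<longrightarrow> finite P \<and> P \<subseteq> polys_in {1..m} \<and> q \<in> polys_in {1..m}"
    "\<forall>a. (\<not> in_image m f a) \<longleftrightarrow> (\<exists>(P, q)\<in>L. locally_closed_at P q a)"
    by (rule constructibleE)
  \<comment> \<open>Otherwise choose a relation free of \<open>j\<close> for each piece; their
    product would vanish on the whole complement.\<close>
  have "\<exists>(P, q)\<in>L. \<forall>d\<in>polys_in W. d \<noteq> 0 \<longrightarrow> (\<exists>x. locally_closed_at P q x \<and> eval_poly x d \<noteq> 0)"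
  proof (rule ccontr)
    assume "\<not> ?thesis"
    hence "\<forall>Pq\<in>L. \<exists>d\<in>polys_in W. d \<noteq> 0 \<and> (\<forall>x. locally_closed_at (fst Pq) (snd Pq) x \<longrightarrow> eval_poly x d = 0)"
      by fastforce
    then obtain d where d: "\<And>Pq. Pq \<in> L \<Longrightarrow> d Pq \<in> polys_in W" "\<And>Pq. Pq \<in> L \<Longrightarrow> d Pq \<noteq> 0"
      "\<And>Pq x. Pq \<in> L \<Longrightarrow> locally_closed_at (fst Pq) (snd Pq) x \<Longrightarrow> eval_poly x (d Pq) = 0"
      by metis
    have "prod d L \<in> polys_in W" "prod d L \<noteq> 0" using d L(1) by auto
    then obtain x where x: "\<not> in_image m f x" "eval_poly x (prod d L) \<noteq> 0" using no unfolding W_def by blast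
    then obtain P q where "(P, q) \<in> L" "locally_closed_at P q x" using L(3) by blast
    hence "eval_poly x (d (P, q)) = 0" using d(3) by force
    thus False using x(2) \<open>(P, q) \<in> L\<close> L(1) by (auto simp: eval_prod)
  qed
  then obtain P q where Pq: "(P, q) \<in> L"
    and big: "\<And>d. d \<in> polys_in W \<Longrightarrow> d \<noteq> 0 \<Longrightarrow> \<exists>x. locally_closed_at P q x \<and> eval_poly x d \<noteq> 0"
    by blast
  have P: "P \<subseteq> polys_in {1..m}" and q: "q \<in> polys_in {1..m}" using L(2) Pq by blast+
  have outside: "\<not> in_image m f x" if "locally_closed_at P q x" for x using L(3) Pq that by blast
  define J where "J = {F \<in> polys_over W. \<forall>x. locally_closed_at P q x \<longrightarrow> poly (specialise x F) (x j) = 0}"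
  have PJ: "uni j p \<in> J" if "p \<in> P" for p
    using that P W by (auto simp: J_def locally_closed_at_def intro!: uni_over)
  show thesis
  proof (cases "\<exists>F\<in>J. F \<noteq> 0")
    case False
    \<comment> \<open>Without relations the piece is the open set where \<open>q\<close> is nonzero.
      As it avoids the image, \<open>q\<close> vanishes on the image, which contradicts algebraic
      independence.\<close>
    hence P0: "p = 0" if "p \<in> P" for p using PJ[OF that] by (metis uni_eq_0_iff)
    obtain x where "locally_closed_at P q x" using big[of 1] by auto
    hence "q \<noteq> 0" by (auto simp: locally_closed_at_def)
    moreover have "eval_poly a (compose_poly f q) = 0" for a
    proof (rule ccontr)
      let ?x = "\<lambda>i. eval_poly a (f i)"
      assume "eval_poly a (compose_poly f q) \<noteq> 0"
      hence "locally_closed_at P q ?x" by (auto simp: locally_closed_at_def eval_compose dest: P0)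
      hence "\<not> in_image m f ?x" by (rule outside)
      thus False by (auto simp: in_image_def)
    qed
    hence "compose_poly f q = 0" by (rule eval_all_0_imp_0)
    ultimately show thesis using compose_eq_0_iff[OF indep q] by simp
  next
    case True
    obtain G where G: "G \<in> J" "G \<noteq> 0"
      and gen: "\<And>F. F \<in> J \<Longrightarrow> \<exists>e. \<exists>S\<in>polys_over W. smult (lead_coeff G ^ e) F = G * S"
    proof (rule exists_generator[of J W])
      show "F * Q \<in> J" if "F \<in> J" "Q \<in> polys_over W" for F Q using that by (auto simp: J_def)
    qed (use True in \<open>auto simp: J_def\<close>)
    have GW: "G \<in> polys_over W" using G by (simp add: J_def)
    let ?p = "poly G (Var j)" and ?l = "lead_coeff G"
    have uG: "uni j ?p = G" using GW W by (simp add: uni_poly)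
    have l: "?l \<in> polys_in W" "?l \<noteq> 0" using GW G by auto
    have eval_p: "eval_poly x ?p = poly (specialise x G) (x j)" for x by (simp add: eval_poly_poly)
    obtain x where x: "locally_closed_at P q x" "eval_poly x ?l \<noteq> 0" using big[OF l] by blast
    show thesis
    proof (rule that[of ?p "q * ?l" x])
      show "?p \<in> polys_in {1..m}" using poly_in_polys[OF GW, of j] W by simp
      show "q * ?l \<in> polys_in {1..m}" using q l polys_in_mono[of W "{1..m}"] by (auto simp: W_def)
      show "?p \<noteq> 0" using uG G by auto
      show "eval_poly x ?p = 0" using G x by (simp add: J_def eval_p)
      show "eval_poly x (q * ?l) \<noteq> 0" using x by (simp add: locally_closed_at_def)
      show "\<forall>z. in_image m f z \<longrightarrow> eval_poly z ?p = 0 \<longrightarrow> eval_poly z (q * ?l) = 0"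
      proof (intro allI impI, rule ccontr)
        fix z assume z: "in_image m f z" "eval_poly z ?p = 0"
        assume nz: "eval_poly z (q * ?l) \<noteq> 0"
        have "eval_poly z p = 0" if pP: "p \<in> P" for p
        proof -
          obtain e S where "smult (?l ^ e) (uni j p) = G * S" using gen[OF PJ[OF pP]] by blast
          from arg_cong[OF this, of "\<lambda>U. eval_poly z (poly U (Var j))"]
          have "eval_poly z ?l ^ e * eval_poly z p = 0" using z(2) by simp
          thus ?thesis using nz by simp
        qed
        hence "locally_closed_at P q z" using nz by (simp add: locally_closed_at_def)
        thus False using outside z by blast
      qed
    qed
  qed
qed

lemma almost_surjective_if_determined_eq:
  fixes f :: "nat \<Rightarrow> 'k::{alg_closed_field, field_char_0} mpoly"
  assumes m: "m \<ge> 1" and f: "\<And>i. i \<in> {1..m} \<Longrightarrow> f i \<in> polys_in {1..n}"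
    and indep: "algebraically_independent m f"
    and det: "determined_polys n m f \<subseteq> compose_poly f ` polys_in {1..m}"
  shows "almost_surjective n m f"
proof (rule ccontr)
  assume "\<not> ?thesis"
  then obtain j where j: "j \<in> {1..m}"
    and no: "\<And>d. d \<in> polys_in ({1..m} - {j}) \<Longrightarrow> d \<noteq> 0 \<Longrightarrow> \<exists>x. \<not> in_image m f x \<and> eval_poly x d \<noteq> 0"
    using almost_surjective_iff[of m f n, OF m f] by blast
  obtain p q x where p: "p \<in> polys_in {1..m}" and q: "q \<in> polys_in {1..m}" and p0: "p \<noteq> 0"
    and zeros: "\<forall>x. in_image m f x \<longrightarrow> eval_poly x p = 0 \<longrightarrow> eval_poly x q = 0"
    and x: "eval_poly x p = 0" "eval_poly x q \<noteq> 0"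
    by (rule hypersurface_outside_image[of m f n j, OF f indep j no])
  let ?P = "compose_poly f p" and ?Q = "compose_poly f q"
  have PQ: "?P \<in> polys_in {1..n}" "?Q \<in> polys_in {1..n}" using f p q by (auto intro: compose_in_polys)
  have P0: "?P \<noteq> 0" using compose_eq_0_iff[OF indep p] p0 by simp
  have sub: "eval_poly a ?Q = 0" if "eval_poly a ?P = 0" for a
    using that zeros[THEN spec, of "\<lambda>i. eval_poly a (f i)"] by (auto simp: eval_compose in_image_def)
  obtain r S where S: "S \<in> polys_in {1..n}" "?Q ^ r = ?P * S"
    using dvd_power_if_zeros_subset[OF _ PQ(1) P0 PQ(2) sub] by blast
  \<comment> \<open>This is the quotient of \<open>?Q ^ Suc r\<close> by \<open>?P\<close>. Where
    \<open>?P\<close> is nonzero, \<open>S\<close> is determined by division; the extra factor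
    \<open>?Q\<close> forces the value 0 where \<open>?P\<close> vanishes.\<close>
  have "S * ?Q \<in> determined_polys n m f"
    unfolding determined_polys_def
  proof (intro CollectI conjI ballI impI)
    fix a b assume ab: "\<forall>i\<in>{1..m}. eval_poly a (f i) = eval_poly b (f i)"
    have Peq: "eval_poly a ?P = eval_poly b ?P" and Qeq: "eval_poly a ?Q = eval_poly b ?Q"
      using eval_compose_in_image[of m "\<lambda>i. eval_poly a (f i)" b f, OF ab] p q by (simp_all add: eval_compose)
    show "eval_poly a (S * ?Q) = eval_poly b (S * ?Q)"
    proof (cases "eval_poly b ?P = 0")
      case True
      thus ?thesis using sub[of a] sub[of b] Peq by simp
    next
      case False
      have "eval_poly b ?P * eval_poly a S = eval_poly b ?P * eval_poly b S"
        using arg_cong[OF S(2), of "eval_poly a"] arg_cong[OF S(2), of "eval_poly b"] Peq Qeq by simp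
      thus ?thesis using False Qeq by simp
    qed
  qed (use S PQ in auto)
  then obtain s where s: "s \<in> polys_in {1..m}" "S * ?Q = compose_poly f s" using det by blast
  have "compose_poly f (p * s) = compose_poly f (q ^ r * q)"
    using s(2) S(2) by (simp flip: s(2) add: mult.assoc)
  \<comment> \<open>Independence lifts the identity to \<open>p * s = q ^ r * q\<close>, which at
    \<open>x\<close> has a zero left side and a nonzero right side.\<close>
  hence "compose_poly f (p * s - q ^ r * q) = 0"
    using semiring_hom_diff[OF semiring_hom_compose] by (metis right_minus_eq)
  hence "p * s - q ^ r * q = 0" using p q s by (subst (asm) compose_eq_0_iff[OF indep]) auto
  hence "eval_poly x (p * s) = eval_poly x (q ^ r * q)" by simp
  thus False using x by simp
qed

section \<open>Determined polynomials\<close>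

lemma exists_two_nonroots:
  fixes p :: "'a::field_char_0 poly"
  assumes "p \<noteq> 0"
  shows "\<exists>x y. x \<noteq> y \<and> poly p x \<noteq> 0 \<and> poly p y \<noteq> 0"
proof -
  obtain x where x: "poly p x \<noteq> 0" using exists_nonroot[OF assms] by blast
  have "p * [:- x, 1:] \<noteq> 0" using assms by (simp add: mult_eq_0_iff del: mult_pCons_right)
  then obtain y where "poly (p * [:- x, 1:]) y \<noteq> 0" using exists_nonroot by blast
  thus ?thesis using x by (intro exI[of _ x] exI[of _ y]) auto
qed

text \<open>The pairs of values of \<open>f\<close> and \<open>g\<close> form the image of
  \<open>h\<close>, in which the last coordinate is a function of the others. A relation
  \<open>w\<close> of least degree in that coordinate therefore has, generically, a single root, and
  \<open>single_root_coeff\<close> expresses it by the coefficients of \<open>w\<close>.\<close>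

lemma determined_imp_rational:
  fixes f :: "nat \<Rightarrow> 'k::{alg_closed_field, field_char_0} mpoly"
  assumes f: "\<And>i. i \<in> {1..m} \<Longrightarrow> f i \<in> polys_in {1..n}"
    and indep: "algebraically_independent m f" and g: "g \<in> determined_polys n m f"
  obtains p q where "p \<in> polys_in {1..m}" "q \<in> polys_in {1..m}" "q \<noteq> 0"
    "compose_poly f q * g = compose_poly f p"
proof -
  \<comment> \<open>The value of \<open>g\<close> becomes a new coordinate with index
    \<open>Suc m\<close>.\<close>
  define V j where "V = {1..m}" and "j = Suc m"
  have Vj: "insert j V = {1..Suc m}" "j \<notin> V" "finite V" by (auto simp: V_def j_def)
  define h where "h = f(j := g)"
  have h: "h i \<in> polys_in {1..n}" if "i \<in> {1..Suc m}" for i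
    using that f[of i] g by (auto simp: h_def j_def determined_polys_def)
  have hj: "h j = g" by (simp add: h_def)
  have hV: "compose_poly h p = compose_poly f p" if "p \<in> polys_in V" for p
    by (rule hom_eq_on_polys[OF semiring_hom_compose semiring_hom_compose that]) (use Vj in \<open>auto simp: h_def\<close>)
  have hV0: "compose_poly h p = 0 \<longleftrightarrow> p = 0" if "p \<in> polys_in V" for p
    using hV[OF that] compose_eq_0_iff[OF indep] that by (simp add: V_def)
  have graph: "x j = y j" if xy: "in_image (Suc m) h x" "in_image (Suc m) h y" "\<And>i. i \<in> V \<Longrightarrow> x i = y i" for x y
  proof -
    obtain a b where a: "\<And>i. i \<in> {1..Suc m} \<Longrightarrow> x i = eval_poly a (h i)"
      and b: "\<And>i. i \<in> {1..Suc m} \<Longrightarrow> y i = eval_poly b (h i)"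
      using xy by (auto simp: in_image_def)
    have "eval_poly (restrict a {1..n}) (f i) = eval_poly (restrict b {1..n}) (f i)" if "i \<in> {1..m}" for i
      using a[of i] b[of i] xy(3)[of i] that f[OF that] by (simp add: V_def h_def j_def eval_restrict)
    hence "eval_poly (restrict a {1..n}) g = eval_poly (restrict b {1..n}) g"
      using g restrict_affine unfolding determined_polys_def by blast
    hence "eval_poly a g = eval_poly b g" using g by (simp add: determined_polys_def eval_restrict)
    thus ?thesis using a[of j] b[of j] hj by (simp add: j_def)
  qed
  have "constructible {1..Suc m} (in_image (Suc m) h)"
    unfolding in_image_def[abs_def] by (rule constructible_image[of "Suc m" h n]) (rule h)
  then obtain L where L: "finite L"
    "\<forall>P q. (P, q) \<in> L \<longrightarrow> finite P \<and> P \<subseteq> polys_in {1..Suc m} \<and> q \<in> polys_in {1..Suc m}"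
    "\<forall>a. in_image (Suc m) h a \<longleftrightarrow> (\<exists>(P, q)\<in>L. locally_closed_at P q a)"
    by (rule constructibleE)
  \<comment> \<open>This piece contains the generic point of the image. If there were none, every
    piece would lie in the zero set of some \<open>w\<close> with
    \<open>compose_poly h w \<noteq> 0\<close>, and the product of these would vanish on the entire
    image.\<close>
  have "\<exists>(P, q)\<in>L. (\<forall>p\<in>P. compose_poly h p = 0) \<and> compose_poly h q \<noteq> 0"
  proof (rule ccontr)
    assume none: "\<not> ?thesis"
    have "\<exists>w\<in>polys_in {1..Suc m}. compose_poly h w \<noteq> 0 \<and> (\<forall>x. locally_closed_at (fst Pq) (snd Pq) x \<longrightarrow> eval_poly x w = 0)"
      if Pq: "Pq \<in> L" for Pq
    proof -
      obtain P q where *: "Pq = (P, q)" "(P, q) \<in> L" using Pq by (cases Pq) auto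
      have q: "q \<in> polys_in {1..Suc m}" using L(2) * by blast
      show ?thesis
      proof (cases "\<exists>p\<in>P. compose_poly h p \<noteq> 0")
        case True
        thus ?thesis using * L(2) by (fastforce simp: locally_closed_at_def)
      next
        case False
        hence q0: "compose_poly h q = 0" using none * by blast
        have "\<not> locally_closed_at P q x" for x
        proof
          assume x: "locally_closed_at P q x"
          hence "in_image (Suc m) h x" using L(3) * by blast
          then obtain a where "\<forall>i\<in>{1..Suc m}. x i = eval_poly a (h i)" by (auto simp: in_image_def)
          from eval_compose_in_image[OF this q] have "eval_poly x q = 0" using q0 by simp
          thus False using x by (simp add: locally_closed_at_def)
        qed
        thus ?thesis using * by (intro bexI[of _ 1]) auto
      qed
    qed
    then obtain w where w: "\<And>Pq. Pq \<in> L \<Longrightarrow> w Pq \<in> polys_in {1..Suc m}"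
      "\<And>Pq. Pq \<in> L \<Longrightarrow> compose_poly h (w Pq) \<noteq> 0"
      "\<And>Pq x. Pq \<in> L \<Longrightarrow> locally_closed_at (fst Pq) (snd Pq) x \<Longrightarrow> eval_poly x (w Pq) = 0"
      by metis
    have "eval_poly a (compose_poly h (prod w L)) = 0" for a
    proof -
      let ?x = "\<lambda>i. eval_poly a (h i)"
      have "in_image (Suc m) h ?x" by (auto simp: in_image_def)
      then obtain P q where "(P, q) \<in> L" "locally_closed_at P q ?x" using L(3) by blast
      hence "eval_poly ?x (w (P, q)) = 0" using w(3) by force
      thus ?thesis using \<open>(P, q) \<in> L\<close> L(1) by (auto simp: eval_compose eval_prod)
    qed
    hence "compose_poly h (prod w L) = 0" by (rule eval_all_0_imp_0)
    thus False using w(2) L(1) by (auto simp: compose_prod)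
  qed
  then obtain P q where Pq: "(P, q) \<in> L" and Ph: "\<And>p. p \<in> P \<Longrightarrow> compose_poly h p = 0" and qh: "compose_poly h q \<noteq> 0"
    by blast
  have P: "P \<subseteq> polys_in (insert j V)" and q: "q \<in> polys_in (insert j V)" using L(2) Pq Vj by auto
  have image: "in_image (Suc m) h x" if "locally_closed_at P q x" for x using L(3) Pq that by blast
  define \<Phi> where "\<Phi> F = compose_poly h (poly F (Var j))" for F
  have \<Phi>_mult: "\<Phi> (F * G) = \<Phi> F * \<Phi> G" and \<Phi>_diff: "\<Phi> (F - G) = \<Phi> F - \<Phi> G"
    and \<Phi>_smult: "\<Phi> (smult c F) = compose_poly h c * \<Phi> F" and \<Phi>_uni: "\<Phi> (uni j p) = compose_poly h p" for F G c p
    using semiring_hom_diff[OF semiring_hom_compose] by (auto simp: \<Phi>_def)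
  \<comment> \<open>The relations that \<open>g\<close> satisfies over the algebra generated by
    \<open>f\<close>.\<close>
  define J where "J = {F \<in> polys_over V. \<Phi> F = 0}"
  have PJ: "uni j p \<in> J" if "p \<in> P" for p
    using that P by (auto simp: J_def \<Phi>_uni Ph intro!: uni_over)
  define Q where "Q = uni j q"
  have Q: "Q \<in> polys_over V" "\<Phi> Q \<noteq> 0" using q qh by (auto simp: Q_def \<Phi>_uni intro: uni_over)
  have "\<exists>F\<in>J. F \<noteq> 0"
  proof (rule ccontr)
    assume "\<not> ?thesis"
    \<comment> \<open>The piece would be open, and some line in direction \<open>j\<close> would
      meet it twice, giving two values of \<open>g\<close> over one point.\<close>
    hence P0: "p = 0" if "p \<in> P" for p using PJ[OF that] by (metis uni_eq_0_iff)
    have "Q \<noteq> 0" using Q(2) by (auto simp: \<Phi>_def)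
    then obtain a where "eval_poly a (lead_coeff Q) \<noteq> 0"
      using exists_eval_nonzero[OF Vj(3), of "lead_coeff Q"] Q by auto
    hence "specialise a Q \<noteq> 0" by (metis coeff_0 coeff_specialise)
    then obtain y z where yz: "y \<noteq> z" "poly (specialise a Q) y \<noteq> 0" "poly (specialise a Q) z \<noteq> 0"
      using exists_two_nonroots by blast
    have "in_image (Suc m) h (a(j := y))" if "poly (specialise a Q) y \<noteq> 0" for y
      using that by (intro image) (auto simp: locally_closed_at_def Q_def poly_specialise_uni dest: P0)
    from this[OF yz(2)] this[OF yz(3)] have "(a(j := y)) j = (a(j := z)) j"
      by (rule graph) (use Vj(2) in auto)
    thus False using yz(1) by simp
  qed
  then obtain w where w: "w \<in> J" "w \<noteq> 0" and min: "\<And>F. F \<in> J \<Longrightarrow> F \<noteq> 0 \<Longrightarrow> degree w \<le> degree F"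
    and gen: "\<And>F. F \<in> J \<Longrightarrow> \<exists>e. \<exists>S\<in>polys_over V. smult (lead_coeff w ^ e) F = w * S"
    by (rule exists_generator[of J V, rotated]) (auto simp: J_def \<Phi>_diff \<Phi>_mult)
  have wV: "w \<in> polys_over V" "\<Phi> w = 0" using w by (auto simp: J_def)
  \<comment> \<open>\<open>w\<close> and \<open>Q\<close> are coprime over the fraction field: their
    common divisor \<open>v\<close> is not a relation because \<open>Q\<close> is none, so the
    cofactor of \<open>v\<close> in \<open>w\<close> is one, and minimality of \<open>w\<close>
    gives \<open>v\<close> degree 0.\<close>
  have "\<exists>c\<in>polys_in V. c \<noteq> 0 \<and> (\<exists>A B. [:c:] = w * A + Q * B)"
  proof -
    obtain v A B e w' e' Q' where v: "v \<in> polys_over V" "v \<noteq> 0" "v = w * A + Q * B"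
      and w': "w' \<in> polys_over V" "smult (lead_coeff v ^ e) w = v * w'"
      and Q': "Q' \<in> polys_over V" "smult (lead_coeff v ^ e') Q = v * Q'"
      by (rule exists_common_divisor[OF wV(1) Q(1) disjI1[OF w(2)]])
    have lv: "lead_coeff v \<in> polys_in V" "lead_coeff v \<noteq> 0" using v(1,2) by auto
    have "\<Phi> v \<noteq> 0"
      using arg_cong[OF Q'(2), of \<Phi>] Q(2) hV0[OF lv(1)] lv(2) by (auto simp: \<Phi>_smult \<Phi>_mult)
    moreover have "\<Phi> v * \<Phi> w' = 0" using arg_cong[OF w'(2), of \<Phi>] wV by (simp add: \<Phi>_smult \<Phi>_mult)
    ultimately have "w' \<in> J" using w' by (simp add: J_def)
    moreover have "w' \<noteq> 0" using w' w lv by auto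
    moreover have "degree w = degree v + degree w'"
      using arg_cong[OF w'(2), of degree] lv v(2) \<open>w' \<noteq> 0\<close> by (simp add: degree_mult_eq)
    ultimately have "degree v = 0" using min[of w'] by simp
    then obtain c where c: "v = [:c:]" by (rule degree_eq_zeroE)
    hence "c \<in> polys_in V" "c \<noteq> 0" using v(1,2) by (auto simp: pCons_over)
    thus ?thesis using v(3) unfolding c by blast
  qed
  then obtain c A B where c: "c \<in> polys_in V" "c \<noteq> 0" "[:c:] = w * A + Q * B" by blast
  define l where "l = lead_coeff w"
  have l: "l \<in> polys_in V" "l \<noteq> 0" using wV w by (auto simp: l_def)
  have "degree w \<noteq> 0"
  proof
    assume "degree w = 0"
    then obtain d where d: "w = [:d:]" by (rule degree_eq_zeroE)
    hence "d \<in> polys_in V" "compose_poly h d = 0" using wV by (auto simp: pCons_over \<Phi>_def)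
    thus False using hV0 d w by auto
  qed
  then obtain s where s: "degree w = Suc s" using not0_implies_Suc by blast
  define b where "b = coeff w s"
  have b: "b \<in> polys_in V" using wV by (auto simp: b_def)
  \<comment> \<open>The single root will be \<open>- b / u\<close>; \<open>u\<close> is nonzero
    because the characteristic is 0.\<close>
  define u where "u = const_poly (of_nat (Suc s)) * l"
  have u: "u \<in> polys_in V" "u \<noteq> 0" using l by (auto simp: u_def simp del: of_nat_Suc)
  \<comment> \<open>Where \<open>l\<close> is nonzero, a root of \<open>w\<close> is a zero of all
    equations in \<open>P\<close>; where \<open>c\<close> is nonzero, the Bezout identity keeps
    \<open>q\<close> nonzero there.\<close>
  have root_image: "in_image (Suc m) h (x(j := y))"
    if x: "eval_poly x l \<noteq> 0" "eval_poly x c \<noteq> 0" and y: "poly (specialise x w) y = 0" for x y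
  proof (rule image)
    have "eval_poly x c = poly (specialise x Q) y * poly (specialise x B) y"
      using arg_cong[OF c(3), of "\<lambda>U. poly (specialise x U) y"] y by simp
    hence "eval_poly (x(j := y)) q \<noteq> 0" using x(2) by (auto simp: Q_def poly_specialise_uni)
    moreover have "eval_poly (x(j := y)) p = 0" if pP: "p \<in> P" for p
    proof -
      obtain e S where "smult (l ^ e) (uni j p) = w * S" using gen[OF PJ[OF pP]] by (auto simp: l_def)
      from arg_cong[OF this, of "\<lambda>U. poly (specialise x U) y"] show ?thesis
        using x(1) y by (simp add: poly_specialise_uni)
    qed
    ultimately show "locally_closed_at P q (x(j := y))" by (simp add: locally_closed_at_def)
  qed
  have "eval_poly a (compose_poly h (l * c * (u * Var j + b))) = 0" for a
  proof -
    define x where "x = (\<lambda>i. eval_poly a (h i))"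
    show ?thesis
    proof (cases "eval_poly x l = 0 \<or> eval_poly x c = 0")
      case True
      thus ?thesis by (auto simp: eval_compose x_def)
    next
      case False
      have "eval_poly x (poly w (Var j)) = 0" using wV by (simp add: \<Phi>_def x_def flip: eval_compose)
      hence root: "poly (specialise x w) (x j) = 0" by (simp add: eval_poly_poly)
      have "degree (specialise x w) = Suc s" using False s by (simp add: degree_specialise_eq l_def)
      moreover have "y = x j" if y: "poly (specialise x w) y = 0" for y
      proof -
        have "in_image (Suc m) h (x(j := y))" "in_image (Suc m) h (x(j := x j))"
          using False y root by (auto intro!: root_image simp del: fun_upd_triv)
        hence "(x(j := y)) j = (x(j := x j)) j" by (rule graph) (use Vj(2) in auto)
        thus ?thesis by simp
      qed
      ultimately have "of_nat (Suc s) * lead_coeff (specialise x w) * x j + coeff (specialise x w) s = 0"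
        by (rule single_root_coeff)
      hence "eval_poly x (u * Var j + b) = 0"
        using \<open>degree (specialise x w) = Suc s\<close> s by (simp add: u_def b_def l_def del: of_nat_Suc)
      thus ?thesis by (simp add: eval_compose x_def)
    qed
  qed
  hence "compose_poly h (l * c * (u * Var j + b)) = 0" by (rule eval_all_0_imp_0)
  hence "compose_poly h u * g + compose_poly h b = 0" using hV0 l c by (simp add: hj)
  hence "compose_poly f u * g = compose_poly f 0 - compose_poly f b"
    unfolding hV[OF u(1)] hV[OF b] by (simp add: eq_neg_iff_add_eq_0)
  also have "\<dots> = compose_poly f (0 - b)" by (rule semiring_hom_diff[OF semiring_hom_compose, symmetric])
  finally have "compose_poly f u * g = compose_poly f (0 - b)" .
  thus thesis using that[of "0 - b" u] u b unfolding V_def by (simp add: diff_in_polys del: diff_0)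
qed

text \<open>After division by the greatest common divisor in the variable \<open>j\<close>, the
  denominator \<open>Q'\<close> cannot have positive degree: a generic zero of it would lie in the
  image by the choice of \<open>\<delta>\<close>, so the numerator \<open>P'\<close> would vanish
  there too, against the Bezout identity.\<close>

lemma denominator_free:
  fixes f :: "nat \<Rightarrow> 'k::{alg_closed_field, field_char_0} mpoly"
  assumes indep: "algebraically_independent m f"
    and p: "p \<in> polys_in {1..m}" and q: "q \<in> polys_in {1..m}" "q \<noteq> 0"
    and g: "compose_poly f q * g = compose_poly f p" and j: "j \<in> {1..m}"
    and \<delta>: "\<delta> \<in> polys_in ({1..m} - {j})" "\<delta> \<noteq> 0" "\<And>x. \<not> in_image m f x \<Longrightarrow> eval_poly x \<delta> = 0"
  shows "\<exists>d\<in>polys_in ({1..m} - {j}). d \<noteq> 0 \<and> (\<exists>S\<in>polys_in {1..m}. d * p = q * S)"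
proof -
  define W where "W = {1..m} - {j}"
  have W: "insert j W = {1..m}" "j \<notin> W" "finite W" using j by (auto simp: W_def)
  define P Q where "P = uni j p" and "Q = uni j q"
  have PQ: "P \<in> polys_over W" "Q \<in> polys_over W" "Q \<noteq> 0"
    using p q W by (auto simp: P_def Q_def intro: uni_over)
  obtain v A B e1 P1 e2 Q1 where v: "v \<in> polys_over W" "v \<noteq> 0" and AB: "v = P * A + Q * B"
    and P1: "P1 \<in> polys_over W" "smult (lead_coeff v ^ e1) P = v * P1"
    and Q1: "Q1 \<in> polys_over W" "smult (lead_coeff v ^ e2) Q = v * Q1"
    by (rule exists_common_divisor[OF PQ(1,2) disjI2[OF PQ(3)]])
  define l where "l = lead_coeff v"
  have l: "l \<in> polys_in W" "l \<noteq> 0" using v(1,2) by (auto simp: l_def)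
  \<comment> \<open>Equalises the exponents, so that \<open>P\<close> and \<open>Q\<close> are
    multiplied by the same factor \<open>k\<close>.\<close>
  define k P' Q' where "k = l ^ (e1 + e2)" and "P' = smult (l ^ e2) P1" and "Q' = smult (l ^ e1) Q1"
  have k: "k \<in> polys_in W" "k \<noteq> 0" using l by (auto simp: k_def)
  have PQ': "P' \<in> polys_over W" "Q' \<in> polys_over W" using P1 Q1 l by (auto simp: P'_def Q'_def)
  have kP: "smult k P = v * P'"
  proof -
    have "smult k P = smult (l ^ e2) (smult (l ^ e1) P)" by (simp add: k_def power_add mult_ac)
    thus ?thesis by (simp add: P1 P'_def l_def)
  qed
  have kQ: "smult k Q = v * Q'"
  proof -
    have "smult k Q = smult (l ^ e1) (smult (l ^ e2) Q)" by (simp add: k_def power_add mult_ac)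
    thus ?thesis by (simp add: Q1 Q'_def l_def)
  qed
  have "v * [:k:] = (smult k P) * A + (smult k Q) * B" by (simp add: AB smult_add_right mult.commute)
  also have "\<dots> = v * (P' * A + Q' * B)" by (simp add: kP kQ algebra_simps)
  finally have kAB: "[:k:] = P' * A + Q' * B" using v(2) by (simp del: mult_pCons_right)
  have "v * (P' * Q) = v * (Q' * P)"
  proof -
    have "v * (P' * Q) = (smult k P) * Q" by (simp add: kP mult.assoc)
    also have "\<dots> = (smult k Q) * P" by (simp add: mult.commute)
    also have "\<dots> = v * (Q' * P)" by (simp add: kQ mult.assoc)
    finally show ?thesis .
  qed
  hence cross: "P' * Q = Q' * P" using v(2) by simp
  define p' q' where "p' = poly P' (Var j)" and "q' = poly Q' (Var j)"
  have pq': "p' \<in> polys_in {1..m}" "q' \<in> polys_in {1..m}"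
    using PQ'[THEN poly_in_polys, of j] W by (auto simp: p'_def q'_def)
  have cross': "p' * q = q' * p"
    using arg_cong[OF cross, of "\<lambda>U. poly U (Var j)"] by (simp add: P_def Q_def p'_def q'_def)
  have "compose_poly f q * compose_poly f p' = compose_poly f q * (compose_poly f q' * g)"
    using arg_cong[OF cross', of "compose_poly f"] g by (simp add: mult_ac)
  hence g': "compose_poly f p' = compose_poly f q' * g" using compose_eq_0_iff[OF indep q(1)] q(2) by simp
  have Q0: "Q' \<noteq> 0" using kQ k PQ(3) by auto
  have "degree Q' = 0"
  proof (rule ccontr)
    assume deg: "degree Q' \<noteq> 0"
    have "lead_coeff Q' * k * \<delta> \<in> polys_in W" "lead_coeff Q' * k * \<delta> \<noteq> 0"
      using PQ' k \<delta> Q0 by (auto simp: W_def)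
    \<comment> \<open>Nonvanishing of the three factors keeps the degree of \<open>Q'\<close>
      positive, excludes common zeros of \<open>P'\<close> and \<open>Q'\<close>, and puts the whole
      line through \<open>x\<close> in direction \<open>j\<close> into the image.\<close>
    then obtain x where "eval_poly x (lead_coeff Q' * k * \<delta>) \<noteq> 0" using exists_eval_nonzero[OF W(3)] by blast
    hence x: "eval_poly x (lead_coeff Q') \<noteq> 0" "eval_poly x k \<noteq> 0" "eval_poly x \<delta> \<noteq> 0" by auto
    have "degree (specialise x Q') > 0" using deg degree_specialise_eq[OF x(1)] by simp
    then obtain y where y: "poly (specialise x Q') y = 0" using alg_closed_imp_poly_has_root by blast
    let ?z = "x(j := y)"
    have "eval_poly ?z \<delta> \<noteq> 0" using x(3) eval_upd[OF \<delta>(1), of j x y] by simp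
    hence "in_image m f ?z" using \<delta>(3)[of ?z] by blast
    then obtain a where a: "\<forall>i\<in>{1..m}. ?z i = eval_poly a (f i)" unfolding in_image_def by (elim exE)
    have "eval_poly ?z q' = poly (specialise x Q') y" "eval_poly ?z p' = poly (specialise x P') y"
      using specialise_upd[OF PQ'(1) W(2)] specialise_upd[OF PQ'(2) W(2)]
      by (simp_all add: p'_def q'_def eval_poly_poly)
    moreover have "eval_poly ?z p' = eval_poly ?z q' * eval_poly a g"
      using arg_cong[OF g', of "eval_poly a"]
      unfolding eval_mult eval_compose_in_image[OF a pq'(1)] eval_compose_in_image[OF a pq'(2)] .
    ultimately have "poly (specialise x P') y = 0" using y by simp
    hence "eval_poly x k = 0" using arg_cong[OF kAB, of "\<lambda>U. poly (specialise x U) y"] y by simp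
    thus False using x(2) by simp
  qed
  then obtain d where d: "Q' = [:d:]" by (rule degree_eq_zeroE)
  have "d \<in> polys_in W" "d \<noteq> 0" using d PQ' Q0 by (auto simp: pCons_over)
  moreover have "d * p = q * p'" using cross' by (simp add: q'_def d mult.commute)
  ultimately show ?thesis using pq' unfolding W_def by blast
qed

text \<open>Almost surjectivity feeds \<open>denominator_free\<close> for every \<open>j\<close>, so
  \<open>q\<close> divides \<open>p\<close>; then \<open>compose_poly f q\<close> can be
  cancelled.\<close>

lemma determined_subset_if_almost_surjective:
  fixes f :: "nat \<Rightarrow> 'k::{alg_closed_field, field_char_0} mpoly"
  assumes m: "m \<ge> 1" and f: "\<And>i. i \<in> {1..m} \<Longrightarrow> f i \<in> polys_in {1..n}"
    and indep: "algebraically_independent m f" and as: "almost_surjective n m f"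
  shows "determined_polys n m f \<subseteq> compose_poly f ` polys_in {1..m}"
proof
  fix g assume g: "g \<in> determined_polys n m f"
  obtain p q where p: "p \<in> polys_in {1..m}" and q: "q \<in> polys_in {1..m}" "q \<noteq> 0"
    and pq: "compose_poly f q * g = compose_poly f p"
    by (rule determined_imp_rational[OF f indep g])
  have "\<exists>S\<in>polys_in {1..m}. p = q * S"
  proof (rule dvd_if_dvd_free_multiples[OF _ q(1) p q(2)])
    fix j assume j: "j \<in> {1..m}"
    have "\<forall>j\<in>{1..m}. \<exists>d\<in>polys_in ({1..m} - {j}). d \<noteq> 0 \<and> (\<forall>x. \<not> in_image m f x \<longrightarrow> eval_poly x d = 0)"
      using as f by (subst (asm) almost_surjective_iff[OF m, of f n]) simp_all
    from bspec[OF this j] obtain \<delta> where \<delta>: "\<delta> \<in> polys_in ({1..m} - {j})" "\<delta> \<noteq> 0"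
      "\<forall>x. \<not> in_image m f x \<longrightarrow> eval_poly x \<delta> = 0" by (elim bexE conjE)
    show "\<exists>d\<in>polys_in ({1..m} - {j}). d \<noteq> 0 \<and> (\<exists>S\<in>polys_in {1..m}. d * p = q * S)"
      by (rule denominator_free[OF indep p q pq j \<delta>(1,2)]) (simp add: \<delta>(3))
  qed simp
  then obtain S where S: "S \<in> polys_in {1..m}" "p = q * S" by blast
  have "compose_poly f q * g = compose_poly f q * compose_poly f S" using pq S by simp
  hence "g = compose_poly f S" using compose_eq_0_iff[OF indep q(1)] q(2) by simp
  thus "g \<in> compose_poly f ` polys_in {1..m}" using S by blast
qed

lemma compose_determined:
  assumes "\<And>i. i \<in> {1..m} \<Longrightarrow> f i \<in> polys_in {1..n}"
  shows "compose_poly f ` polys_in {1..m} \<subseteq> determined_polys n m f"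
proof
  fix g assume "g \<in> compose_poly f ` polys_in {1..m}"
  then obtain s where s: "s \<in> polys_in {1..m}" "g = compose_poly f s" by blast
  have "g \<in> polys_in {1..n}" unfolding s(2) by (rule compose_in_polys[OF s(1)]) (rule assms)
  moreover have "eval_poly a g = eval_poly b g" if "\<forall>i\<in>{1..m}. eval_poly a (f i) = eval_poly b (f i)" for a b
    unfolding s(2) eval_compose by (rule eval_cong[OF s(1)]) (use that in auto)
  ultimately show "g \<in> determined_polys n m f" by (auto simp: determined_polys_def)
qed

theorem theorem3p4:
  fixes f :: "nat \<Rightarrow> 'k::{alg_closed_field, field_char_0} mpoly" and m n :: nat
  assumes "m \<ge> 1" and "n \<ge> 1"
    and "\<And>i. i \<in> {1..m} \<Longrightarrow> f i \<in> polys_in {1..n}"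
    and "algebraically_independent m f"
  shows "determined_polys n m f = generated_subalgebra (f ` {1..m}) \<longleftrightarrow> almost_surjective n m f"
proof
  assume "determined_polys n m f = generated_subalgebra (f ` {1..m})"
  hence "determined_polys n m f \<subseteq> compose_poly f ` polys_in {1..m}"
    by (simp only: generated_subalgebra_eq order_refl)
  thus "almost_surjective n m f"
    using assms almost_surjective_if_determined_eq[of m f n] by simp
next
  assume "almost_surjective n m f"
  thus "determined_polys n m f = generated_subalgebra (f ` {1..m})"
    unfolding generated_subalgebra_eq
    using assms compose_determined[of m f n] determined_subset_if_almost_surjective[of m f n]
    by (intro equalityI) simp_all
qed

end
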